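(* Let $\lambda$ be a partition with $d=\ell(\lambda)$ parts and $\mu$ a partition with $[\mu]\subseteq[\lambda]$. Then $$f^{\lambda/\mu}=\frac{|\lambda/\mu|!}{\prod_{u\in[\lambda]}h(u)}\sum_{D\in\mathcal{OOE}(\lambda/\mu)}\ \prod_{(i,j)\in D}(\lambda_{d+1-i}+i-j).$$
   Context: $f^{\lambda/\mu}$ is the number of standard Young tableaux of shape $\lambda/\mu$; $h(u)$ is the hook length of $u$ in $\lambda$; $c(i,j)=j-i$. Excited diagrams in the region $\Lambda^d=\{(i,j):1\le i\le d,\ j\ge1\}$: start with the cells of $[\mu]$ and repeatedly apply excited moves, where a cell $(i,j)\in D$ is replaced by $(i+1,j+1)$ provided $(i+1,j),(i,j+1),(i+1,j+1)$ are in the region and not in $D$; the set of all resulting diagrams is $\mathcal E(\Lambda^d/\mu)$. For $D\in\mathcal E(\Lambda^d/\mu)$, let $\varphi(D)$ be the tableau of shape $\mu$ whose entry in cell $u$ is the row number of the cell to which $u$ has been moved in $D$; $\varphi$ is a bijection from $\mathcal E(\Lambda^d/\mu)$ to the set $\mathrm{SSYT}(\mu,d)$ of semistandard Young tableaux of shape $\mu$ with entries at most $d$. $\mathcal{OOT}(\lambda/\mu)$ is the set of $T\in\mathrm{SSYT}(\mu,d)$ with $c(u)<\lambda_{d+1-T(u)}$ for all $u\in[\mu]$, and $\mathcal{OOE}(\lambda/\mu)=\varphi^{-1}(\mathcal{OOT}(\lambda/\mu))$, i.e. the set of diagrams $\{(T(u),T(u)+c(u)):u\in[\mu]\}$ for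 $T\in\mathcal{OOT}(\lambda/\mu)$. *)

theory Defs
  imports Complex_Main "HOL-Library.FuncSet"
begin

(* Rows and columns are numbered from 1 (matrix convention, row first). *)
type_synonym cell = "nat \<times> nat"

(* A partition is the list of its positive parts, so its length is the number of parts. *)
definition is_partition :: "nat list \<Rightarrow> bool" where
  "is_partition la \<longleftrightarrow> sorted_wrt (\<ge>) la \<and> (\<forall>x\<in>set la. 0 < x)"

definition part :: "nat list \<Rightarrow> nat \<Rightarrow> nat" where
  "part la i = (if 1 \<le> i \<and> i \<le> length la then la ! (i - 1) else 0)"

definition diagram :: "nat list \<Rightarrow> cell set" where
  "diagram la = {(i, j). 1 \<le> i \<and> i \<le> length la \<and> 1 \<le> j \<and> j \<le> part la i}"

definition skew_diagram :: "nat list \<Rightarrow> nat list \<Rightarrow> cell set" where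
  "skew_diagram la mu = diagram la - diagram mu"

definition content :: "cell \<Rightarrow> int" where
  "content u = int (snd u) - int (fst u)"

definition hook :: "nat list \<Rightarrow> cell \<Rightarrow> cell set" where
  "hook la u = {(i, j). (i, j) \<in> diagram la \<and>
     (i = fst u \<and> snd u \<le> j \<or> j = snd u \<and> fst u \<le> i)}"

definition hook_length :: "nat list \<Rightarrow> cell \<Rightarrow> nat" where
  "hook_length la u = card (hook la u)"

(* Tableaux are functions that take the value undefined outside their shape,
   so that distinct functions are distinct tableaux. *)

(* The inequalities between adjacent cells suffice, since a row or a column
   of a skew shape is an interval. *)
definition skew_SYT :: "nat list \<Rightarrow> nat list \<Rightarrow> (cell \<Rightarrow> nat) set" where
  "skew_SYT la mu = {T \<in> extensional (skew_diagram la mu).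
     bij_betw T (skew_diagram la mu) {1..card (skew_diagram la mu)} \<and>
     (\<forall>i j. (i, j) \<in> skew_diagram la mu \<and> (i, j + 1) \<in> skew_diagram la mu
        \<longrightarrow> T (i, j) < T (i, j + 1)) \<and>
     (\<forall>i j. (i, j) \<in> skew_diagram la mu \<and> (i + 1, j) \<in> skew_diagram la mu
        \<longrightarrow> T (i, j) < T (i + 1, j))}"

definition num_skew_SYT :: "nat list \<Rightarrow> nat list \<Rightarrow> nat" where
  "num_skew_SYT la mu = card (skew_SYT la mu)"

definition SSYT :: "nat list \<Rightarrow> nat \<Rightarrow> (cell \<Rightarrow> nat) set" where
  "SSYT mu d = {T \<in> diagram mu \<rightarrow>\<^sub>E {1..d}.
     (\<forall>i j. (i, j) \<in> diagram mu \<and> (i, j + 1) \<in> diagram mu \<longrightarrow> T (i, j) \<le> T (i, j + 1)) \<and>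
     (\<forall>i j. (i, j) \<in> diagram mu \<and> (i + 1, j) \<in> diagram mu \<longrightarrow> T (i, j) < T (i + 1, j))}"

definition region :: "nat \<Rightarrow> cell set" where
  "region d = {(i, j). 1 \<le> i \<and> i \<le> d \<and> 1 \<le> j}"

definition excitable :: "nat \<Rightarrow> cell set \<Rightarrow> cell \<Rightarrow> bool" where
  "excitable d D u \<longleftrightarrow> u \<in> D \<and>
     (case u of (i, j) \<Rightarrow> {(i + 1, j), (i, j + 1), (i + 1, j + 1)} \<subseteq> region d - D)"

definition shift :: "cell \<Rightarrow> cell" where
  "shift u = (fst u + 1, snd u + 1)"

inductive_set excited_diagrams :: "nat \<Rightarrow> nat list \<Rightarrow> cell set set"
  for d :: nat and mu :: "nat list" where
  start: "diagram mu \<in> excited_diagrams d mu"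
| move: "D \<in> excited_diagrams d mu \<Longrightarrow> excitable d D u \<Longrightarrow>
    insert (shift u) (D - {u}) \<in> excited_diagrams d mu"

(* The same process with labelled cells: g u is the current position of the cell
   that started at u, and the current diagram is g ` diagram mu. *)
inductive_set excited_placements :: "nat \<Rightarrow> nat list \<Rightarrow> (cell \<Rightarrow> cell) set"
  for d :: nat and mu :: "nat list" where
  start: "restrict (\<lambda>u. u) (diagram mu) \<in> excited_placements d mu"
| move: "g \<in> excited_placements d mu \<Longrightarrow> u \<in> diagram mu \<Longrightarrow>
    excitable d (g ` diagram mu) (g u) \<Longrightarrow>
    g(u := shift (g u)) \<in> excited_placements d mu"

(* Well defined on excited diagrams: every cell stays on its diagonal and cells on
   the same diagonal never overtake each other, so D determines the placement. *)
definition phi :: "nat \<Rightarrow> nat list \<Rightarrow> cell set \<Rightarrow> (cell \<Rightarrow> nat)" where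
  "phi d mu D = (THE T. \<exists>g\<in>excited_placements d mu.
     g ` diagram mu = D \<and> T = restrict (\<lambda>u. fst (g u)) (diagram mu))"

definition OOT :: "nat list \<Rightarrow> nat list \<Rightarrow> (cell \<Rightarrow> nat) set" where
  "OOT la mu = {T \<in> SSYT mu (length la).
     \<forall>u\<in>diagram mu. content u < int (part la (length la + 1 - T u))}"

definition OOE :: "nat list \<Rightarrow> nat list \<Rightarrow> cell set set" where
  "OOE la mu = {D \<in> excited_diagrams (length la) mu. phi (length la) mu D \<in> OOT la mu}"

end

theory Submission
  imports "Jordan_Normal_Form.Determinant" Defs
begin

text \<open>
  The right-hand side is a disguised evaluation of a shifted Schur function. Write \<open>d\<close> for the number
  of parts of \<open>\<lambda>\<close>, and let \<open>s\<close> be the sum over all semistandard tableaux \<open>T\<close> of shape \<open>\<mu>\<close> with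
  entries at most \<open>d\<close> of the products of the factors \<open>\<lambda>\<^bsub>d+1-T(u)\<^esub> - c(u)\<close>. Moving the cell \<open>u\<close> to
  row \<open>T(u)\<close> along its diagonal turns \<open>T\<close> into an excited diagram, and every excited diagram arises
  from exactly one \<open>T\<close>, because entries increase strictly along diagonals and an excited move is
  precisely an increment of one entry that keeps the tableau semistandard
  (\<open>excitable_imp_ssyt\<close>, \<open>ssyt_imp_excitable\<close>, \<open>placement_image_inj\<close>). The tableaux that violate
  \<open>c(u) < \<lambda>\<^bsub>d+1-T(u)\<^esub>\<close> contribute zero: along a row the factors start positive and drop by at most
  one per step, so they cannot become negative without passing through zero (\<open>factors_positive\<close>).
  Hence the sum in the theorem is \<open>s\<close> (\<open>sum_OOE\<close>).

  It remains to prove the Okounkov--Olshanski formula: the number of standard tableaux times the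
  product \<open>H\<close> of the hook lengths is \<open>|\<lambda>/\<mu>|! s\<close>. Both sides satisfy the same recursion when a cell is
  added to \<open>\<mu>\<close>. On the left, the position of the entry 1 is a minimal cell of the skew shape
  (\<open>card_syt_recursion\<close>). On the right, \<open>(|\<lambda>| - |\<mu>|) s\<^sub>\<mu>\<close> is the sum of \<open>s\<^sub>\<nu>\<close> over the partitions
  \<open>\<nu>\<close> that arise by adding a cell (\<open>shifted_schur_pieri\<close>), and \<open>s\<^sub>\<nu>\<close> vanishes if \<open>\<nu>\<close> is not
  contained in \<open>\<lambda>\<close> (\<open>shifted_schur_vanish\<close>). The induction ends at \<open>\<mu> = \<lambda>\<close>, where
  \<open>s = H\<close> (\<open>shifted_schur_eq_hook_product\<close>).

  The recursion and the initial value come from a determinant. With \<open>l\<^sub>i = x\<^sub>i + d - i\<close> and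
  \<open>m\<^sub>k = \<mu>\<^sub>k + d - k\<close>, the shifted Schur function of \<open>x\<close> times the Vandermonde product of \<open>l\<close> is the
  determinant of the falling factorials of \<open>l\<^sub>i\<close> of length \<open>m\<^sub>k\<close>
  (\<open>shifted_schur_determinant\<close>), since both obey the same branching rule: removing the entries \<open>d\<close>
  from a tableau corresponds to clearing the column of \<open>l\<^sub>1\<close> in the matrix. Adding a cell to row \<open>k\<close> multiplies the
  entries of matrix row \<open>k\<close> by \<open>l\<^sub>i - m\<^sub>k\<close>, which gives the recursion, and for \<open>\<mu> = \<lambda>\<close> the matrix is
  triangular.
\<close>

section \<open>Tableaux on sets of cells\<close>

text \<open>
  The excited-diagram argument uses of a partition diagram only that it is a finite order ideal of
  cells; the branching argument needs coordinates, for which \<open>row_shape\<close> below is used.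
\<close>

definition young :: "cell set \<Rightarrow> bool" where
  "young S \<longleftrightarrow> finite S \<and> (\<forall>(i, j)\<in>S. 1 \<le> i \<and> 1 \<le> j) \<and>
     (\<forall>i j i' j'. (i, j) \<in> S \<longrightarrow> 1 \<le> i' \<longrightarrow> i' \<le> i \<longrightarrow> 1 \<le> j' \<longrightarrow> j' \<le> j \<longrightarrow> (i', j') \<in> S)"

text \<open>
  Tableaux are taken on arbitrary sets of cells, since removing the entries \<open>d\<close> or the entry 1
  leads from a diagram to other sets; on \<^term>\<open>diagram mu\<close> this is \<^term>\<open>SSYT mu d\<close>.
\<close>

definition ssyt :: "cell set \<Rightarrow> nat \<Rightarrow> (cell \<Rightarrow> nat) set" where
  "ssyt S d = {T \<in> S \<rightarrow>\<^sub>E {1..d}.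
     (\<forall>i j. (i, j) \<in> S \<and> (i, j + 1) \<in> S \<longrightarrow> T (i, j) \<le> T (i, j + 1)) \<and>
     (\<forall>i j. (i, j) \<in> S \<and> (i + 1, j) \<in> S \<longrightarrow> T (i, j) < T (i + 1, j))}"

text \<open>
  Row lengths are a function indexed from 0, like the rows of a matrix, and trailing rows may be empty,
  so that adding a cell or dropping the last row needs no renormalization. The cells themselves are
  numbered from 1.
\<close>

definition row_shape :: "nat \<Rightarrow> (nat \<Rightarrow> nat) \<Rightarrow> cell set" where
  "row_shape d mu = {(i, j). 1 \<le> i \<and> i \<le> d \<and> 1 \<le> j \<and> j \<le> mu (i - 1)}"

lemma row_shape_eq_Sigma: "row_shape d mu = (\<lambda>(i, j). (Suc i, Suc j)) ` (SIGMA i:{..<d}. {..<mu i})"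
proof -
  have "u \<in> (\<lambda>(i, j). (Suc i, Suc j)) ` (SIGMA i:{..<d}. {..<mu i})" if "u \<in> row_shape d mu" for u
    using that unfolding row_shape_def
    by (intro image_eqI[where x = "(fst u - 1, snd u - 1)"]) auto
  then show ?thesis by (auto simp: row_shape_def)
qed

lemma finite_row_shape [simp]: "finite (row_shape d mu)"
  unfolding row_shape_eq_Sigma by (intro finite_imageI finite_SigmaI) auto

lemma prod_row_shape:
  fixes f :: "cell \<Rightarrow> 'a::comm_monoid_mult"
  shows "prod f (row_shape d mu) = (\<Prod>i<d. \<Prod>j<mu i. f (Suc i, Suc j))"
  unfolding row_shape_eq_Sigma
  by (subst prod.reindex) (auto simp: inj_on_def prod.Sigma intro!: prod.cong)

lemma card_row_shape: "card (row_shape d mu) = (\<Sum>i<d. mu i)"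
  unfolding row_shape_eq_Sigma
  by (subst card_image) (auto simp: inj_on_def)

lemma young_row_shape: "antimono_on {..<d} mu \<Longrightarrow> young (row_shape d mu)"
  unfolding young_def
proof (intro conjI)
  assume *: "antimono_on {..<d} mu"
  show "\<forall>i j i' j'. (i, j) \<in> row_shape d mu \<longrightarrow> 1 \<le> i' \<longrightarrow> i' \<le> i \<longrightarrow> 1 \<le> j' \<longrightarrow> j' \<le> j \<longrightarrow> (i', j') \<in> row_shape d mu"
  proof (intro allI impI)
    fix i j i' j' assume h: "(i, j) \<in> row_shape d mu" "1 \<le> i'" "i' \<le> i" "1 \<le> j'" "j' \<le> j"
    then have "mu (i - 1) \<le> mu (i' - 1)"
      by (intro monotone_onD[OF *]) (auto simp: row_shape_def)
    with h show "(i', j') \<in> row_shape d mu" by (auto simp: row_shape_def)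
  qed
  show "finite (row_shape d mu)" by simp
  show "\<forall>(i, j)\<in>row_shape d mu. 1 \<le> i \<and> 1 \<le> j" by (auto simp: row_shape_def)
qed

text \<open>
  Walk right along row \<open>p\<close>, then down column \<open>j\<close>; all cells on the way belong to an order ideal,
  and every step down raises the entry by at least one.
\<close>

lemma ssyt_monotone:
  assumes S: "young S" and T: "T \<in> ssyt S d"
    and "(p, q) \<in> S" "(i, j) \<in> S" "p \<le> i" "q \<le> j"
  shows "T (p, q) + (i - p) \<le> T (i, j)"
proof -
  have down: "(i', j') \<in> S" if "1 \<le> i'" "i' \<le> i" "1 \<le> j'" "j' \<le> j" for i' j'
    using S \<open>(i, j) \<in> S\<close> that unfolding young_def by blast
  have pos: "1 \<le> p" "1 \<le> q" using S \<open>(p, q) \<in> S\<close> unfolding young_def by auto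
  have "T (p, q) \<le> T (p, j)"
    using \<open>q \<le> j\<close> down
  proof (induction j rule: dec_induct)
    case (step n)
    have "(p, n) \<in> S" "(p, n + 1) \<in> S"
      using step.prems[of p n] step.prems[of p "n+1"] step.hyps pos \<open>p \<le> i\<close> by auto
    then have "T (p, n) \<le> T (p, n + 1)" using T unfolding ssyt_def by blast
    with step show ?case by simp
  qed simp
  moreover have "T (p, j) + (i - p) \<le> T (i, j)"
    using \<open>p \<le> i\<close> down
  proof (induction i rule: dec_induct)
    case (step n)
    have "(n, j) \<in> S" "(n + 1, j) \<in> S"
      using step.prems[of n j] step.prems[of "n+1" j] step.hyps pos \<open>q \<le> j\<close> by auto
    then have "T (n, j) < T (n + 1, j)" using T unfolding ssyt_def by blast
    with step show ?case by simp
  qed simp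
  ultimately show ?thesis by simp
qed

lemma ssyt_ge_row:
  assumes S: "young S" and T: "T \<in> ssyt S d" and u: "(i, j) \<in> S"
  shows "i \<le> T (i, j)"
proof -
  have *: "1 \<le> i" "1 \<le> j" "(1, j) \<in> S" using S u unfolding young_def by auto
  then have "1 \<le> T (1, j)" using T unfolding ssyt_def by (auto dest: PiE_mem)
  with ssyt_monotone[OF S T *(3) u] * show ?thesis by simp
qed

section \<open>Shifted Schur functions and their branching rule\<close>

definition weight :: "nat \<Rightarrow> (nat \<Rightarrow> real) \<Rightarrow> cell set \<Rightarrow> (cell \<Rightarrow> nat) \<Rightarrow> real" where
  "weight d x S T = (\<Prod>u\<in>S. x (d - T u) - of_int (content u))"

text \<open>
  The combinatorial formula for shifted Schur functions. Because of the reversal \<open>d - T u\<close>, the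
  largest possible entry \<open>d\<close> carries the variable \<^term>\<open>x 0\<close>.
\<close>

definition shifted_schur :: "nat \<Rightarrow> (nat \<Rightarrow> real) \<Rightarrow> cell set \<Rightarrow> real" where
  "shifted_schur d x S = (\<Sum>T\<in>ssyt S d. weight d x S T)"

text \<open>
  The entries below the maximum form a shape that interlaces with \<open>mu\<close>: the entry under a cell is larger,
  so at most one maximal entry occurs per column, and the last row consists of maximal entries only.
\<close>

lemma ssyt_remove_largest:
  assumes mu: "antimono_on {..<Suc d} mu" and T: "T \<in> ssyt (row_shape (Suc d) mu) (Suc d)"
  obtains nu where "nu \<in> (\<Pi>\<^sub>E i\<in>{..<d}. {mu (Suc i)..mu i})"
    "{u \<in> row_shape (Suc d) mu. T u \<le> d} = row_shape d nu"
proof -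
  let ?S = "row_shape (Suc d) mu"
  note S = young_row_shape[OF mu]
  define Q where "Q i = {q \<in> {1..mu i}. T (Suc i, q) \<le> d}" for i
  have mono: "T (Suc i, q) \<le> T (Suc i, q')" if "1 \<le> q" "q \<le> q'" "q' \<le> mu i" "i < Suc d" for i q q'
    using ssyt_monotone[OF S T, of "Suc i" q "Suc i" q'] that by (auto simp: row_shape_def)
  have Q: "Q i = {1..card (Q i)}" if "i < Suc d" for i
  proof -
    have fin: "finite (Q i)" by (auto simp: Q_def)
    have "q \<in> Q i" if "q' \<in> Q i" "1 \<le> q" "q \<le> q'" for q q'
      using that mono[of q q' i] \<open>i < Suc d\<close> by (auto simp: Q_def)
    then have sub: "{1..q} \<subseteq> Q i" if "q \<in> Q i" for q using that by auto
    have "q \<le> card (Q i)" if "q \<in> Q i" for q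
      using card_mono[OF fin sub[OF that]] by simp
    then have "Q i \<subseteq> {1..card (Q i)}" by (auto simp: Q_def)
    then show ?thesis by (intro card_subset_eq) auto
  qed
  define nu where "nu = (\<lambda>i\<in>{..<d}. card (Q i))"
  have le: "card (Q i) \<le> mu i" for i
  proof -
    have "Q i \<subseteq> {1..mu i}" by (auto simp: Q_def)
    from card_mono[OF _ this] show ?thesis by simp
  qed
  have ge: "mu (Suc i) \<le> card (Q i)" if "i < d" for i
  proof -
    have "{1..mu (Suc i)} \<subseteq> Q i"
    proof
      fix q assume q: "q \<in> {1..mu (Suc i)}"
      have "mu (Suc i) \<le> mu i" using that by (intro monotone_onD[OF mu]) auto
      then have c: "(Suc i, q) \<in> ?S" "(Suc (Suc i), q) \<in> ?S" using q that by (auto simp: row_shape_def)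
      from ssyt_monotone[OF S T c] have "T (Suc i, q) < T (Suc (Suc i), q)" by simp
      moreover have "T (Suc (Suc i), q) \<le> Suc d" using T c unfolding ssyt_def by (auto dest: PiE_mem)
      ultimately show "q \<in> Q i" using c by (auto simp: Q_def row_shape_def)
    qed
    moreover have "finite (Q i)" by (auto simp: Q_def)
    ultimately show ?thesis using card_mono[of "Q i" "{1..mu (Suc i)}"] by simp
  qed
  have "nu \<in> (\<Pi>\<^sub>E i\<in>{..<d}. {mu (Suc i)..mu i})"
    using le ge by (auto simp: nu_def)
  moreover have "{u \<in> ?S. T u \<le> d} = row_shape d nu"
  proof -
    have "(i, j) \<in> {u \<in> ?S. T u \<le> d} \<longleftrightarrow> (i, j) \<in> row_shape d nu" for i j
    proof (cases "1 \<le> i \<and> i \<le> d")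
      case True
      then obtain k where k: "i = Suc k" "k < d" by (cases i) auto
      have "(i, j) \<in> {u \<in> ?S. T u \<le> d} \<longleftrightarrow> j \<in> Q k"
        using k by (auto simp: row_shape_def Q_def)
      also have "\<dots> \<longleftrightarrow> j \<in> {1..card (Q k)}" using Q[of k] k by simp
      also have "\<dots> \<longleftrightarrow> (i, j) \<in> row_shape d nu"
        using k by (auto simp: row_shape_def nu_def)
      finally show ?thesis .
    next
      case False
      then show ?thesis using ssyt_ge_row[OF S T, of i j] by (auto simp: row_shape_def)
    qed
    then show ?thesis by auto
  qed
  ultimately show thesis by (rule that)
qed

lemma row_shape_inj:
  assumes "row_shape d nu = row_shape d nu'" "nu \<in> extensional {..<d}" "nu' \<in> extensional {..<d}"
  shows "nu = nu'"
proof (rule extensionalityI[OF assms(2,3)])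
  fix i assume i: "i \<in> {..<d}"
  have "{1..nu i} = {1..nu' i}"
  proof -
    have "j \<in> {1..nu i} \<longleftrightarrow> (Suc i, j) \<in> row_shape d nu" for j using i by (auto simp: row_shape_def)
    moreover have "j \<in> {1..nu' i} \<longleftrightarrow> (Suc i, j) \<in> row_shape d nu'" for j using i by (auto simp: row_shape_def)
    ultimately show ?thesis using assms(1) by blast
  qed
  then show "nu i = nu' i" by (metis card_atLeastAtMost diff_Suc_1)
qed

lemma finite_ssyt: "finite S \<Longrightarrow> finite (ssyt S d)"
  unfolding ssyt_def by (rule finite_subset[of _ "S \<rightarrow>\<^sub>E {1..d}"]) (auto intro: finite_PiE)

lemma ssyt_restrict:
  assumes T: "T \<in> ssyt S d'" and R: "R \<subseteq> S" "\<And>u. u \<in> R \<Longrightarrow> T u \<le> d"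
  shows "restrict T R \<in> ssyt R d"
  using assms unfolding ssyt_def by (fastforce simp: PiE_iff subset_iff)

lemma interlacing_antimono:
  fixes mu nu :: "nat \<Rightarrow> nat"
  assumes "nu \<in> (\<Pi>\<^sub>E i\<in>{..<d}. {mu (Suc i)..mu i})"
  shows "antimono_on {..<d} nu"
proof (rule monotone_onI)
  fix i j assume ij: "i \<in> {..<d}" "j \<in> {..<d}" "i \<le> j"
  have nu: "mu (Suc k) \<le> nu k" "nu k \<le> mu k" if "k < d" for k
    using PiE_mem[OF assms, of k] that by auto
  from \<open>i \<le> j\<close> ij(2) show "nu j \<le> nu i"
  proof (induction j rule: dec_induct)
    case (step n)
    then have "nu (Suc n) \<le> mu (Suc n)" "mu (Suc n) \<le> nu n" "nu n \<le> nu i"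
      using nu(1)[of n] nu(2)[of "Suc n"] by simp_all
    then show ?case by linarith
  qed simp
qed

lemma interlacing_subset:
  assumes "nu \<in> (\<Pi>\<^sub>E i\<in>{..<d}. {mu (Suc i)..mu i})"
  shows "row_shape d nu \<subseteq> row_shape (Suc d) mu"
proof
  fix u assume "u \<in> row_shape d nu"
  then obtain i j where u: "u = (Suc i, j)" "i < d" "1 \<le> j" "j \<le> nu i"
    unfolding row_shape_def by (cases u, cases "fst u") auto
  from PiE_mem[OF assms, of i] u(2) have "nu i \<le> mu i" by simp
  with u show "u \<in> row_shape (Suc d) mu" by (simp add: row_shape_def)
qed

text \<open>
  Filling the strip between interlacing shapes with a new largest entry keeps the columns strict,
  because a cell with a cell of \<open>mu\<close> below it already lies in the smaller shape.
\<close>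

lemma ssyt_extend:
  assumes nu: "nu \<in> (\<Pi>\<^sub>E i\<in>{..<d}. {mu (Suc i)..mu i})" and T: "T \<in> ssyt (row_shape d nu) d"
  shows "(\<lambda>u\<in>row_shape (Suc d) mu. if u \<in> row_shape d nu then T u else Suc d)
     \<in> ssyt (row_shape (Suc d) mu) (Suc d)"
proof -
  let ?S = "row_shape (Suc d) mu" and ?R = "row_shape d nu"
  have R: "young ?R" by (rule young_row_shape[OF interlacing_antimono[OF nu]])
  have sub: "?R \<subseteq> ?S" by (rule interlacing_subset[OF nu])
  have Tle: "1 \<le> T u \<and> T u \<le> d" if "u \<in> ?R" for u using T that unfolding ssyt_def by (auto dest: PiE_mem)
  have row: "T (i, j) \<le> T (i, j + 1)" if "(i, j) \<in> ?R" "(i, j + 1) \<in> ?R" for i j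
    using T that unfolding ssyt_def by blast
  have col: "T (i, j) < T (i + 1, j)" if "(i, j) \<in> ?R" "(i + 1, j) \<in> ?R" for i j
    using T that unfolding ssyt_def by blast
  have rowR: "(i, j) \<in> ?R" if "(i, j) \<in> ?S" "(i, j + 1) \<in> ?R" for i j
    using that by (auto simp: row_shape_def)
  have colR: "(i, j) \<in> ?R" if "(i, j) \<in> ?S" "(i + 1, j) \<in> ?S" for i j
    using that PiE_mem[OF nu, of "i - 1"] by (cases i) (auto simp: row_shape_def)
  show ?thesis unfolding ssyt_def
    apply (safe intro!: PiE_I)
    subgoal for a b using Tle[of "(a,b)"] by auto
    subgoal by simp
    subgoal for i j using rowR row Tle[of "(i,j)"] by auto
    subgoal for i j using colR[of i j] col[of i j] Tle[of "(i,j)"] by auto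
    done
qed

text \<open>
  A tableau is the same as the interlacing shape occupied by its entries at most \<open>d\<close> together with
  a tableau on that shape; the remaining cells carry the entry \<open>Suc d\<close>, hence the variable \<^term>\<open>x 0\<close>.
\<close>

lemma shifted_schur_branching:
  assumes mu: "antimono_on {..<Suc d} mu"
  shows "shifted_schur (Suc d) x (row_shape (Suc d) mu) =
    (\<Sum>nu\<in>(\<Pi>\<^sub>E i\<in>{..<d}. {mu (Suc i)..mu i}).
       (\<Prod>u\<in>row_shape (Suc d) mu - row_shape d nu. x 0 - of_int (content u)) *
       shifted_schur d (x \<circ> Suc) (row_shape d nu))"
proof -
  let ?S = "row_shape (Suc d) mu" and ?I = "\<Pi>\<^sub>E i\<in>{..<d}. {mu (Suc i)..mu i}"
  define nuT where "nuT T = (THE nu. nu \<in> ?I \<and> {u \<in> ?S. T u \<le> d} = row_shape d nu)" for T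
  have uniq: "nu = nu'" if "nu \<in> ?I" "nu' \<in> ?I" "row_shape d nu = row_shape d nu'" for nu nu'
    by (rule row_shape_inj[OF that(3)]) (use that(1,2) in \<open>simp_all add: PiE_iff\<close>)
  have nuT: "nuT T = nu" if "nu \<in> ?I" "{u \<in> ?S. T u \<le> d} = row_shape d nu" for T nu
    unfolding nuT_def
  proof (rule the_equality)
    show "nu \<in> ?I \<and> {u \<in> ?S. T u \<le> d} = row_shape d nu" using that by (rule conjI)
    fix nu' assume "nu' \<in> ?I \<and> {u \<in> ?S. T u \<le> d} = row_shape d nu'"
    then show "nu' = nu" using that by (intro uniq[OF _ that(1)]) simp_all
  qed
  have nuT': "nuT T \<in> ?I" "{u \<in> ?S. T u \<le> d} = row_shape d (nuT T)" if T: "T \<in> ssyt ?S (Suc d)" for T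
  proof -
    obtain nu where nu: "nu \<in> ?I" "{u \<in> ?S. T u \<le> d} = row_shape d nu"
      by (rule ssyt_remove_largest[OF mu T])
    have "nuT T = nu" by (rule nuT[OF nu])
    with nu show "nuT T \<in> ?I" "{u \<in> ?S. T u \<le> d} = row_shape d (nuT T)" by simp_all
  qed
  note sub = interlacing_subset
  have Tle: "T u \<le> d" if "T \<in> ssyt R d" "u \<in> R" for T R u using that unfolding ssyt_def by (auto dest: PiE_mem)
  let ?ext = "\<lambda>(nu, T). \<lambda>u\<in>?S. if u \<in> row_shape d nu then T u else Suc d"
  have ext_lev: "{u \<in> ?S. ?ext (nu, T) u \<le> d} = row_shape d nu"
    if "nu \<in> ?I" "T \<in> ssyt (row_shape d nu) d" for nu T
  proof
    show "{u \<in> ?S. ?ext (nu, T) u \<le> d} \<subseteq> row_shape d nu" by (auto split: if_splits)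
    show "row_shape d nu \<subseteq> {u \<in> ?S. ?ext (nu, T) u \<le> d}"
    proof
      fix u assume u: "u \<in> row_shape d nu"
      with subsetD[OF sub[OF that(1)] u] Tle[OF that(2) u] show "u \<in> {u \<in> ?S. ?ext (nu, T) u \<le> d}" by simp
    qed
  qed
  have "shifted_schur (Suc d) x ?S = (\<Sum>(nu, T)\<in>(SIGMA nu:?I. ssyt (row_shape d nu) d).
      (\<Prod>u\<in>?S - row_shape d nu. x 0 - of_int (content u)) * weight d (x \<circ> Suc) (row_shape d nu) T)"
    unfolding shifted_schur_def
  proof (rule sum.reindex_bij_witness[where i = ?ext and j = "\<lambda>T. (nuT T, restrict T (row_shape d (nuT T)))"])
    fix T assume T: "T \<in> ssyt ?S (Suc d)"
    note nT = nuT'[OF T]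
    have lev: "u \<in> row_shape d (nuT T) \<longleftrightarrow> u \<in> ?S \<and> T u \<le> d" for u
      unfolding nT(2)[symmetric] by simp
    have sd: "T u = Suc d" if "u \<in> ?S" "u \<notin> row_shape d (nuT T)" for u
    proof -
      have "T u \<le> Suc d" using T that(1) by (auto simp: ssyt_def dest: PiE_mem)
      then show ?thesis using that lev[of u] by auto
    qed
    have ext: "T \<in> extensional ?S" using T by (auto simp: ssyt_def PiE_def)
    show "?ext (nuT T, restrict T (row_shape d (nuT T))) = T"
    proof
      fix u show "?ext (nuT T, restrict T (row_shape d (nuT T))) u = T u"
        using sd[of u] extensional_arb[OF ext, of u] by auto
    qed
    show "(nuT T, restrict T (row_shape d (nuT T))) \<in> (SIGMA nu:?I. ssyt (row_shape d nu) d)"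
    proof (rule SigmaI)
      show "nuT T \<in> ?I" by (rule nT(1))
      show "restrict T (row_shape d (nuT T)) \<in> ssyt (row_shape d (nuT T)) d"
        by (rule ssyt_restrict[OF T sub[OF nT(1)]]) (simp add: lev)
    qed
    have "weight (Suc d) x ?S T = (\<Prod>u\<in>?S - row_shape d (nuT T). x (Suc d - T u) - of_int (content u)) *
        (\<Prod>u\<in>row_shape d (nuT T). x (Suc d - T u) - of_int (content u))"
      unfolding weight_def by (rule prod.subset_diff[OF sub[OF nT(1)]]) simp
    also have "(\<Prod>u\<in>row_shape d (nuT T). x (Suc d - T u) - of_int (content u)) =
       weight d (x \<circ> Suc) (row_shape d (nuT T)) (restrict T (row_shape d (nuT T)))"
      unfolding weight_def
    proof (rule prod.cong[OF refl])
      fix u assume "u \<in> row_shape d (nuT T)"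
      moreover from this have "T u \<le> d" using lev by blast
      ultimately show "x (Suc d - T u) - of_int (content u) =
        (x \<circ> Suc) (d - restrict T (row_shape d (nuT T)) u) - of_int (content u)"
        by (simp add: Suc_diff_le)
    qed
    also have "(\<Prod>u\<in>?S - row_shape d (nuT T). x (Suc d - T u) - of_int (content u)) =
       (\<Prod>u\<in>?S - row_shape d (nuT T). x 0 - of_int (content u))"
      by (rule prod.cong) (auto dest: sd)
    finally show "(case (nuT T, restrict T (row_shape d (nuT T))) of (nu, T) \<Rightarrow>
        (\<Prod>u\<in>?S - row_shape d nu. x 0 - of_int (content u)) * weight d (x \<circ> Suc) (row_shape d nu) T)
        = weight (Suc d) x ?S T" by (simp only: prod.case)
  next
    fix p assume "p \<in> (SIGMA nu:?I. ssyt (row_shape d nu) d)"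
    then obtain nu T where p: "p = (nu, T)" "nu \<in> ?I" "T \<in> ssyt (row_shape d nu) d" by auto
    have nT: "nuT (?ext p) = nu" unfolding p(1) by (rule nuT[OF p(2) ext_lev[OF p(2,3)]])
    have ext: "T \<in> extensional (row_shape d nu)" using p(3) by (auto simp: ssyt_def PiE_def)
    have res: "restrict (?ext p) (row_shape d nu) = T"
    proof
      fix u show "restrict (?ext p) (row_shape d nu) u = T u"
        using subsetD[OF sub[OF p(2)], of u] extensional_arb[OF ext, of u]
        by (cases "u \<in> row_shape d nu") (simp_all add: p(1))
    qed
    show "(nuT (?ext p), restrict (?ext p) (row_shape d (nuT (?ext p)))) = p"
      unfolding nT res by (rule p(1)[symmetric])
    show "?ext p \<in> ssyt ?S (Suc d)" unfolding p(1) prod.case by (rule ssyt_extend[OF p(2,3)])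
  qed
  also have "\<dots> = (\<Sum>nu\<in>?I. \<Sum>T\<in>ssyt (row_shape d nu) d.
      (\<Prod>u\<in>?S - row_shape d nu. x 0 - of_int (content u)) * weight d (x \<circ> Suc) (row_shape d nu) T)"
  proof (rule sum.Sigma[symmetric])
    show "finite ?I" by (rule finite_PiE) auto
    show "\<forall>nu\<in>?I. finite (ssyt (row_shape d nu) d)" by (simp add: finite_ssyt)
  qed
  finally show ?thesis by (simp only: shifted_schur_def sum_distrib_left)
qed

section \<open>Determinants of falling factorials\<close>

definition falling :: "real \<Rightarrow> nat \<Rightarrow> real" where
  "falling a m = (\<Prod>t<m. a - real t)"

text \<open>
  The row index \<open>k\<close> belongs to the exponent and the column index \<open>i\<close> to the variable, so that changing one
  part of the partition changes one row.
\<close>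

definition falling_det :: "nat \<Rightarrow> (nat \<Rightarrow> real) \<Rightarrow> (nat \<Rightarrow> nat) \<Rightarrow> real" where
  "falling_det d l m = det (mat d d (\<lambda>(k, i). falling (l i) (m k)))"

lemma det_mat_permutations:
  "det (mat d d f) = (\<Sum>p\<in>{p. p permutes {0..<d}}. signof p * (\<Prod>k=0..<d. f (k, p k)))"
proof -
  have "det (mat d d f) = (\<Sum>p\<in>{p. p permutes {0..<d}}. signof p * (\<Prod>k=0..<d. mat d d f $$ (k, p k)))"
    by (rule det_def') simp
  also have "\<dots> = (\<Sum>p\<in>{p. p permutes {0..<d}}. signof p * (\<Prod>k=0..<d. f (k, p k)))"
  proof (intro sum.cong refl, rule arg_cong[where f = "\<lambda>z. _ * z"], rule prod.cong[OF refl])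
    fix p k assume "p \<in> {p. p permutes {0..<d}}" "k \<in> {0..<d}"
    moreover from this have "p k \<in> {0..<d}" using permutes_in_image[of p "{0..<d}" k] by simp
    ultimately show "mat d d f $$ (k, p k) = f (k, p k)" by simp
  qed
  finally show ?thesis .
qed

lemma falling_det_cong:
  assumes "\<And>k. k < d \<Longrightarrow> m k = m' k"
  shows "falling_det d l m = falling_det d l m'"
  unfolding falling_det_def using assms by (intro arg_cong[where f = det] cong_mat) auto

lemma falling_Suc: "falling a (Suc m) = falling a m * (a - real m)"
  by (simp add: falling_def)

text \<open>
  Raising one exponent multiplies the entry chosen in row \<open>k\<close> by \<open>l (p k) - m k\<close>. Summed over \<open>k\<close>,
  these factors no longer depend on the permutation \<open>p\<close>.
\<close>

lemma falling_det_pieri: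
  "(\<Sum>k<d. falling_det d l (m(k := Suc (m k)))) =
     ((\<Sum>i<d. l i) - (\<Sum>k<d. real (m k))) * falling_det d l m"
proof -
  have one: "(\<Prod>j=0..<d. falling (l (p j)) ((m(k := Suc (m k))) j)) =
      (\<Prod>j=0..<d. falling (l (p j)) (m j)) * (l (p k) - real (m k))" if "k < d" for p k
  proof -
    have "(\<Prod>j\<in>{0..<d} - {k}. falling (l (p j)) ((m(k := Suc (m k))) j)) =
       (\<Prod>j\<in>{0..<d} - {k}. falling (l (p j)) (m j))"
      by (rule prod.cong) auto
    then show ?thesis
      using that by (simp add: prod.remove[of "{0..<d}" k] falling_Suc)
  qed
  have "(\<Sum>k<d. falling_det d l (m(k := Suc (m k)))) =
     (\<Sum>k<d. \<Sum>p\<in>{p. p permutes {0..<d}}.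
        signof p * (\<Prod>j=0..<d. falling (l (p j)) (m j)) * (l (p k) - real (m k)))"
    unfolding falling_det_def det_mat_permutations
    by (intro sum.cong refl) (simp add: one mult.assoc del: fun_upd_apply)
  also have "\<dots> = (\<Sum>p\<in>{p. p permutes {0..<d}}.
        signof p * (\<Prod>j=0..<d. falling (l (p j)) (m j)) * (\<Sum>k<d. l (p k) - real (m k)))"
    by (subst sum.swap) (simp add: sum_distrib_left)
  also have "\<dots> = (\<Sum>p\<in>{p. p permutes {0..<d}}.
        signof p * (\<Prod>j=0..<d. falling (l (p j)) (m j)) * ((\<Sum>i<d. l i) - (\<Sum>k<d. real (m k))))"
  proof (intro sum.cong refl arg_cong[where f = "\<lambda>z. _ * z"])
    fix p assume "p \<in> {p. p permutes {0..<d}}"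
    then have "(\<Sum>k=0..<d. l (p k)) = (\<Sum>i=0..<d. l i)"
      using sum.permute[of p "{0..<d}" l] by (simp add: o_def)
    then show "(\<Sum>k<d. l (p k) - real (m k)) = (\<Sum>i<d. l i) - (\<Sum>k<d. real (m k))"
      by (simp add: sum_subtractf atLeast0LessThan)
  qed
  also have "\<dots> = ((\<Sum>i<d. l i) - (\<Sum>k<d. real (m k))) * falling_det d l m"
    unfolding falling_det_def det_mat_permutations by (simp add: sum_distrib_left mult_ac)
  finally show ?thesis .
qed

lemma falling_det_repeat:
  assumes "i < d" "j < d" "i \<noteq> j" "m i = m j"
  shows "falling_det d l m = 0"
  unfolding falling_det_def
  by (rule det_identical_rows[of _ d i j]) (use assms in \<open>auto simp: row_def\<close>)

text \<open>
  Multilinearity of the determinant in all rows at once, together with a factor for each column.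
\<close>

lemma det_row_sums:
  fixes c :: "nat \<Rightarrow> real"
  assumes "\<And>k. k < d \<Longrightarrow> finite (B k)"
  shows "det (mat d d (\<lambda>(k, i). c i * (\<Sum>s\<in>B k. a k s * f s i))) =
    (\<Prod>i<d. c i) * (\<Sum>g\<in>PiE {..<d} B. (\<Prod>k<d. a k (g k)) * det (mat d d (\<lambda>(k, i). f (g k) i)))"
proof -
  have c: "(\<Prod>k<d. c (p k)) = (\<Prod>i<d. c i)" if "p permutes {..<d}" for p
    using prod.permute[OF that, of c] by (simp add: o_def atLeast0LessThan)
  have expand: "(\<Prod>k<d. \<Sum>s\<in>B k. a k s * f s (p k)) =
     (\<Sum>g\<in>PiE {..<d} B. (\<Prod>k<d. a k (g k)) * (\<Prod>k<d. f (g k) (p k)))" for p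
    by (subst prod_sum_PiE) (use assms in \<open>auto simp: prod.distrib\<close>)
  have "det (mat d d (\<lambda>(k, i). c i * (\<Sum>s\<in>B k. a k s * f s i))) =
     (\<Sum>p\<in>{p. p permutes {0..<d}}. signof p * ((\<Prod>i<d. c i) * (\<Prod>k<d. \<Sum>s\<in>B k. a k s * f s (p k))))"
    unfolding det_mat_permutations
    by (intro sum.cong refl) (simp add: prod.distrib c atLeast0LessThan)
  also have "\<dots> = (\<Sum>p\<in>{p. p permutes {0..<d}}. \<Sum>g\<in>PiE {..<d} B.
      signof p * ((\<Prod>i<d. c i) * ((\<Prod>k<d. a k (g k)) * (\<Prod>k<d. f (g k) (p k)))))"
    by (simp add: expand sum_distrib_left)
  also have "\<dots> = (\<Prod>i<d. c i) * (\<Sum>g\<in>PiE {..<d} B. (\<Prod>k<d. a k (g k)) * det (mat d d (\<lambda>(k, i). f (g k) i)))"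
    unfolding det_mat_permutations
    by (subst sum.swap) (simp add: sum_distrib_left atLeast0LessThan mult_ac)
  finally show ?thesis .
qed

text \<open>
  The difference of two products is telescoped by exchanging the factors \<open>y - t\<close> for \<open>z - t\<close> one at a time; each
  exchange contributes the factor \<open>y - z\<close>. The summation index \<open>s\<close> becomes the part of the interlacing
  partition in the branching rule.
\<close>

lemma prod_diff_telescope:
  fixes y z :: real
  assumes "a \<le> b"
  shows "falling y b - falling y a * (\<Prod>t=a..<b. z - real t) =
    (y - z) * (\<Sum>s=a..<b. (\<Prod>t=Suc s..<b. z - real t) * falling y s)"
  using assms
proof (induction b rule: dec_induct)
  case (step n)
  have ring: "F * (y - z) + e * ((y - z) * S) = (y - z) * (F + e * S)" for F S e :: real
    by (simp add: algebra_simps)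
  have sum: "(\<Sum>s=a..<Suc n. (\<Prod>t=Suc s..<Suc n. z - real t) * falling y s) =
     falling y n + (z - real n) * (\<Sum>s=a..<n. (\<Prod>t=Suc s..<n. z - real t) * falling y s)"
    using step.hyps by (simp add: sum_distrib_left mult_ac)
  have "falling y (Suc n) - falling y a * (\<Prod>t=a..<Suc n. z - real t) =
    falling y n * (y - z) + (z - real n) * (falling y n - falling y a * (\<Prod>t=a..<n. z - real t))"
    using step.hyps by (simp add: falling_Suc algebra_simps)
  then show ?case unfolding step.IH sum ring .
qed simp

lemma falling_split:
  assumes "a \<le> b"
  shows "falling z b = falling z a * (\<Prod>t=a..<b. z - real t)"
  using assms unfolding falling_def
  by (metis atLeast0LessThan le0 prod.atLeastLessThan_concat)

text \<open>
  Subtracting a suitable multiple of the next row from every row but the last annihilates column 0, apart from its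
  last entry. Expansion along that column leaves a minor whose entries are given by
  \<open>prod_diff_telescope\<close>. The sign of the cofactor cancels against the signs in \<open>l (Suc i) - l 0\<close>.
\<close>

lemma falling_det_branching:
  assumes m: "\<And>k. k < d \<Longrightarrow> m (Suc k) \<le> m k"
  shows "falling_det (Suc d) l m =
    (\<Prod>i<d. l 0 - l (Suc i)) * falling (l 0) (m d) *
    (\<Sum>g\<in>(\<Pi>\<^sub>E k\<in>{..<d}. {m (Suc k)..<m k}).
       (\<Prod>k<d. \<Prod>t=Suc (g k)..<m k. l 0 - real t) * falling_det d (l \<circ> Suc) g)"
proof -
  let ?n = "Suc d"
  define M where "M = mat ?n ?n (\<lambda>(k, i). falling (l i) (m k))"
  \<comment> \<open>The quotient of the entries of rows k and k + 1 in column 0.\<close>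
  define w where "w k = (\<Prod>t=m (Suc k)..<m k. l 0 - real t)" for k
  define L where "L = mat ?n ?n (\<lambda>(k, j). if j = k then 1 else if j = Suc k then - w k else 0 :: real)"
  define N where "N = mat ?n ?n (\<lambda>(k, i). if k < d then falling (l i) (m k) - w k * falling (l i) (m (Suc k))
     else falling (l i) (m k))"
  have "L * M = N"
  proof (rule eq_matI)
    fix k i assume ki: "k < dim_row N" "i < dim_col N"
    then have ki': "k < ?n" "i < ?n" by (auto simp: N_def)
    have "(L * M) $$ (k, i) = (\<Sum>j\<in>{0..<?n}. L $$ (k, j) * M $$ (j, i))"
      using ki' by (simp add: L_def M_def scalar_prod_def)
    also have "\<dots> = (\<Sum>j\<in>{0..<?n} \<inter> {k, Suc k}. L $$ (k, j) * M $$ (j, i))"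
      using ki' by (intro sum.mono_neutral_right) (auto simp: L_def)
    also have "\<dots> = N $$ (k, i)"
    proof (cases "k < d")
      case True
      then have "{0..<?n} \<inter> {k, Suc k} = {k, Suc k}" by auto
      then show ?thesis using True ki' by (simp add: L_def M_def N_def)
    next
      case False
      then have "{0..<?n} \<inter> {k, Suc k} = {k}" "k = d" using ki' by auto
      then show ?thesis using False ki' by (simp add: L_def M_def N_def)
    qed
    finally show "(L * M) $$ (k, i) = N $$ (k, i)" .
  qed (auto simp: L_def M_def N_def)
  moreover have "det (L * M) = det L * det M"
    by (rule det_mult[of _ ?n]) (auto simp: L_def M_def)
  moreover have "det L = 1"
  proof -
    have "det L = prod_list (diag_mat L)"
      by (rule det_upper_triangular[of _ ?n]) (auto simp: L_def upper_triangular_def)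
    also have "\<dots> = (\<Prod>i=0..<?n. L $$ (i, i))" by (simp add: prod_list_diag_prod L_def)
    also have "\<dots> = 1" by (simp add: L_def)
    finally show ?thesis .
  qed
  ultimately have "falling_det ?n l m = det N" by (simp add: falling_det_def M_def)
  also have "\<dots> = (\<Sum>k<?n. N $$ (k, 0) * cofactor N k 0)"
    by (rule laplace_expansion_column) (auto simp: N_def)
  also have "\<dots> = falling (l 0) (m d) * cofactor N d 0"
  proof -
    have "N $$ (k, 0) = 0" if "k < d" for k
      using that falling_split[OF m[OF that], of "l 0"] by (simp add: N_def w_def)
    then show ?thesis by (simp add: N_def)
  qed
  also have "cofactor N d 0 = (-1) ^ d * det (mat_delete N d 0)" by (simp add: cofactor_def)
  also have "mat_delete N d 0 = mat d d (\<lambda>(k, i). (l (Suc i) - l 0) *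
      (\<Sum>s\<in>{m (Suc k)..<m k}. (\<Prod>t=Suc s..<m k. l 0 - real t) * falling (l (Suc i)) s))"
    using prod_diff_telescope[OF m]
    by (intro eq_matI) (auto simp: mat_delete_def N_def w_def mult.commute)
  also have "det \<dots> = (\<Prod>i<d. l (Suc i) - l 0) *
     (\<Sum>g\<in>(\<Pi>\<^sub>E k\<in>{..<d}. {m (Suc k)..<m k}).
       (\<Prod>k<d. \<Prod>t=Suc (g k)..<m k. l 0 - real t) * falling_det d (l \<circ> Suc) g)"
    by (subst det_row_sums) (auto simp: falling_det_def)
  also have "(\<Prod>i<d. l (Suc i) - l 0) = (-1) ^ d * (\<Prod>i<d. l 0 - l (Suc i))"
    using prod.distrib[of "\<lambda>_. -1::real" "\<lambda>i. l 0 - l (Suc i)" "{..<d}"] by simp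
  finally show ?thesis by (simp add: o_def mult_ac flip: power_mult_distrib)
qed

section \<open>The determinantal formula for shifted Schur functions\<close>

text \<open>
  Adding the staircase \<open>d - 1, \<dots>, 1, 0\<close> makes the parts of a partition strictly decreasing.
\<close>

abbreviation staircase :: "nat \<Rightarrow> (nat \<Rightarrow> real) \<Rightarrow> nat \<Rightarrow> real" where
  "staircase d x i \<equiv> x i + real (d - Suc i)"

abbreviation staircase_nat :: "nat \<Rightarrow> (nat \<Rightarrow> nat) \<Rightarrow> nat \<Rightarrow> nat" where
  "staircase_nat d mu i \<equiv> mu i + (d - Suc i)"

definition vandermonde :: "nat \<Rightarrow> (nat \<Rightarrow> real) \<Rightarrow> real" where
  "vandermonde d l = (\<Prod>i<d. \<Prod>k=Suc i..<d. l i - l k)"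

lemma vandermonde_Suc:
  "vandermonde (Suc d) l = (\<Prod>i<d. l 0 - l (Suc i)) * vandermonde d (l \<circ> Suc)"
proof -
  have sh: "(\<Prod>k=Suc i..<Suc d. f k) = (\<Prod>k=i..<d. f (Suc k))" for i and f :: "nat \<Rightarrow> real"
    by (rule prod.shift_bounds_Suc_ivl)
  show ?thesis
    unfolding vandermonde_def prod.lessThan_Suc_shift sh by (simp add: atLeast0LessThan o_def)
qed

text \<open>
  In row \<open>i\<close> the contents of the strip, shifted by \<open>d\<close>, form the interval of integers between the
  staircase-shifted parts; row \<open>d\<close> lies in the strip entirely and gives a full falling factorial.
\<close>

lemma strip_product:
  assumes mu: "antimono_on {..<Suc d} mu" and nu: "nu \<in> (\<Pi>\<^sub>E i\<in>{..<d}. {mu (Suc i)..mu i})"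
  shows "(\<Prod>u\<in>row_shape (Suc d) mu - row_shape d nu. a - of_int (content u)) =
    (\<Prod>i<d. \<Prod>t=Suc (nu i + (d - Suc i))..<mu i + (d - i). (a + real d) - real t) * falling (a + real d) (mu d)"
proof -
  let ?R = "SIGMA i:{..<d}. {nu i..<mu i}" and ?L = "{d} \<times> {..<mu d}"
  let ?f = "\<lambda>u::cell. a - of_int (content u)" and ?e = "\<lambda>(i, j). (Suc i, Suc j)"
  have inj: "inj ?e" by (auto simp: inj_def)
  have "row_shape (Suc d) mu - row_shape d nu =
      ?e ` ((SIGMA i:{..<Suc d}. {..<mu i}) - (SIGMA i:{..<d}. {..<nu i}))"
    unfolding row_shape_eq_Sigma by (rule image_set_diff[OF inj, symmetric])
  also have "(SIGMA i:{..<Suc d}. {..<mu i}) - (SIGMA i:{..<d}. {..<nu i}) = ?R \<union> ?L"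
    by (auto simp: less_Suc_eq)
  finally have "row_shape (Suc d) mu - row_shape d nu = ?e ` (?R \<union> ?L)" .
  moreover have "inj_on ?e (?R \<union> ?L)" using inj by (rule inj_on_subset) simp
  ultimately have "prod ?f (row_shape (Suc d) mu - row_shape d nu) = (\<Prod>(i, j)\<in>?R \<union> ?L. ?f (Suc i, Suc j))"
    by (simp add: prod.reindex split_beta')
  also have "\<dots> = (\<Prod>(i, j)\<in>?R. ?f (Suc i, Suc j)) * (\<Prod>(i, j)\<in>?L. ?f (Suc i, Suc j))"
    by (rule prod.union_disjoint) auto
  also have "(\<Prod>(i, j)\<in>?L. ?f (Suc i, Suc j)) = (\<Prod>i\<in>{d}. \<Prod>j<mu d. ?f (Suc i, Suc j))"
    by (rule prod.Sigma[symmetric]) auto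
  also have "\<dots> = falling (a + real d) (mu d)"
    by (simp add: falling_def content_def algebra_simps)
  also have "(\<Prod>(i, j)\<in>?R. ?f (Suc i, Suc j)) = (\<Prod>i<d. \<Prod>j=nu i..<mu i. ?f (Suc i, Suc j))"
    by (rule prod.Sigma[symmetric]) auto
  also have "\<dots> = (\<Prod>i<d. \<Prod>t=Suc (nu i + (d - Suc i))..<mu i + (d - i). (a + real d) - real t)"
  proof (rule prod.cong[OF refl])
    fix i assume "i \<in> {..<d}"
    then have i: "Suc (nu i + (d - Suc i)) = nu i + (d - i)" "i \<le> d" by auto
    have "(\<Prod>t=nu i + (d - i)..<mu i + (d - i). (a + real d) - real t) =
        (\<Prod>j=nu i..<mu i. (a + real d) - real (j + (d - i)))"
      by (rule prod.shift_bounds_nat_ivl)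
    also have "\<dots> = (\<Prod>j=nu i..<mu i. ?f (Suc i, Suc j))"
      using i(2) by (intro prod.cong) (auto simp: content_def of_nat_diff)
    finally show "(\<Prod>j=nu i..<mu i. ?f (Suc i, Suc j)) =
      (\<Prod>t=Suc (nu i + (d - Suc i))..<mu i + (d - i). (a + real d) - real t)" unfolding i by simp
  qed
  finally show ?thesis .
qed

text \<open>
  Induction on \<open>d\<close>: the strict interval for \<open>g k\<close> in the branching rule of the determinant turns into the weak
  interlacing condition for partitions once the staircases of lengths \<open>Suc d\<close> and \<open>d\<close> are subtracted.
\<close>

theorem shifted_schur_determinant:
  assumes "antimono_on {..<d} mu"
  shows "shifted_schur d x (row_shape d mu) * vandermonde d (staircase d x) =
    falling_det d (staircase d x) (staircase_nat d mu)"
  using assms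
proof (induction d arbitrary: x mu)
  case 0
  have "row_shape 0 mu = {}" by (auto simp: row_shape_def)
  moreover have "ssyt {} 0 = {\<lambda>_. undefined}" by (auto simp: ssyt_def)
  ultimately show ?case
    by (simp add: shifted_schur_def weight_def vandermonde_def falling_det_def)
next
  case (Suc d)
  define l where "l = staircase (Suc d) x"
  define m where "m = staircase_nat (Suc d) mu"
  have l0: "l 0 = x 0 + real d" by (simp add: l_def)
  have lS: "l \<circ> Suc = staircase d (x \<circ> Suc)" by (auto simp: l_def)
  have md: "m d = mu d" by (simp add: m_def)
  let ?I = "\<Pi>\<^sub>E i\<in>{..<d}. {mu (Suc i)..mu i}" and ?J = "\<Pi>\<^sub>E k\<in>{..<d}. {m (Suc k)..<m k}"
  have mu_le: "mu (Suc k) \<le> mu k" if "k < d" for k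
    using that by (intro monotone_onD[OF Suc.prems]) auto
  have m_le: "m (Suc k) \<le> m k" if "k < d" for k
    using that mu_le[OF that] by (simp add: m_def)
  have "falling_det (Suc d) l m = (\<Prod>i<d. l 0 - l (Suc i)) * falling (l 0) (m d) *
    (\<Sum>g\<in>?J. (\<Prod>k<d. \<Prod>t=Suc (g k)..<m k. l 0 - real t) * falling_det d (l \<circ> Suc) g)"
    by (rule falling_det_branching) (rule m_le)
  also have "(\<Sum>g\<in>?J. (\<Prod>k<d. \<Prod>t=Suc (g k)..<m k. l 0 - real t) * falling_det d (l \<circ> Suc) g) =
    (\<Sum>nu\<in>?I. (\<Prod>i<d. \<Prod>t=Suc (nu i + (d - Suc i))..<m i. l 0 - real t) *
       falling_det d (l \<circ> Suc) (staircase_nat d nu))"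
  proof (rule sum.reindex_bij_witness[where i = "\<lambda>nu. restrict (staircase_nat d nu) {..<d}"
        and j = "\<lambda>g. \<lambda>k\<in>{..<d}. g k - (d - Suc k)"])
    fix g assume g: "g \<in> ?J"
    have gk: "staircase_nat d (\<lambda>k\<in>{..<d}. g k - (d - Suc k)) k = g k" if "k < d" for k
    proof -
      have "d - Suc k \<le> g k" using PiE_mem[OF g, of k] that by (auto simp: m_def)
      then show ?thesis using that by (simp only: restrict_apply' lessThan_iff le_add_diff_inverse2)
    qed
    show "restrict (staircase_nat d (\<lambda>k\<in>{..<d}. g k - (d - Suc k))) {..<d} = g"
    proof
      fix k show "restrict (staircase_nat d (\<lambda>k\<in>{..<d}. g k - (d - Suc k))) {..<d} k = g k"
        using PiE_arb[OF g, of k, symmetric] gk[of k]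
        by (cases "k < d") (simp_all only: restrict_apply lessThan_iff if_True if_False not_False_eq_True)
    qed
    show "(\<lambda>k\<in>{..<d}. g k - (d - Suc k)) \<in> ?I"
    proof (rule restrict_PiE_iff[THEN iffD2], safe)
      fix k assume "k < d"
      then show "g k - (d - Suc k) \<in> {mu (Suc k)..mu k}"
        using PiE_mem[OF g, of k] by (auto simp: m_def)
    qed
    have "falling_det d (l \<circ> Suc) (staircase_nat d (\<lambda>k\<in>{..<d}. g k - (d - Suc k))) =
       falling_det d (l \<circ> Suc) g"
      by (rule falling_det_cong) (rule gk)
    moreover have "(\<Prod>i<d. \<Prod>t=Suc (staircase_nat d (\<lambda>k\<in>{..<d}. g k - (d - Suc k)) i)..<m i. l 0 - real t) =
       (\<Prod>k<d. \<Prod>t=Suc (g k)..<m k. l 0 - real t)"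
      by (intro prod.cong refl) (simp only: gk lessThan_iff)
    ultimately show "(\<Prod>i<d. \<Prod>t=Suc ((\<lambda>k\<in>{..<d}. g k - (d - Suc k)) i + (d - Suc i))..<m i. l 0 - real t) *
       falling_det d (l \<circ> Suc) (staircase_nat d (\<lambda>k\<in>{..<d}. g k - (d - Suc k))) =
       (\<Prod>k<d. \<Prod>t=Suc (g k)..<m k. l 0 - real t) * falling_det d (l \<circ> Suc) g"
      by (simp only:)
  next
    fix nu assume nu: "nu \<in> ?I"
    show "(\<lambda>k\<in>{..<d}. restrict (staircase_nat d nu) {..<d} k - (d - Suc k)) = nu"
      using PiE_arb[OF nu] by (auto simp: fun_eq_iff)
    show "restrict (staircase_nat d nu) {..<d} \<in> ?J"
    proof (rule restrict_PiE_iff[THEN iffD2], safe)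
      fix k assume "k < d"
      then show "staircase_nat d nu k \<in> {m (Suc k)..<m k}"
        using PiE_mem[OF nu, of k] by (auto simp: m_def)
    qed
  qed
  also have "\<dots> = (\<Sum>nu\<in>?I. (\<Prod>i<d. \<Prod>t=Suc (nu i + (d - Suc i))..<m i. l 0 - real t) *
       (shifted_schur d (x \<circ> Suc) (row_shape d nu) * vandermonde d (l \<circ> Suc)))"
    unfolding lS by (intro sum.cong refl) (simp only: Suc.IH interlacing_antimono)
  finally have "falling_det (Suc d) l m = (\<Prod>i<d. l 0 - l (Suc i)) * vandermonde d (l \<circ> Suc) *
    (\<Sum>nu\<in>?I. (\<Prod>i<d. \<Prod>t=Suc (nu i + (d - Suc i))..<m i. l 0 - real t) * falling (l 0) (m d) *
       shifted_schur d (x \<circ> Suc) (row_shape d nu))"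
    by (simp add: sum_distrib_left mult_ac)
  also have "\<dots> = vandermonde (Suc d) l * shifted_schur (Suc d) x (row_shape (Suc d) mu)"
    unfolding shifted_schur_branching[OF Suc.prems] vandermonde_Suc l0 md
    by (intro arg_cong2[where f = "(*)"] refl sum.cong)
       (simp only: strip_product[OF Suc.prems], simp add: m_def)
  finally show ?case by (simp add: l_def m_def mult.commute)
qed

section \<open>Adding a cell and vanishing\<close>

lemma vandermonde_staircase_pos:
  assumes "antimono_on {..<d} x"
  shows "0 < vandermonde d (staircase d x)"
proof -
  have "0 < staircase d x i - staircase d x k" if "i < k" "k < d" for i k
  proof -
    have "real (d - Suc k) < real (d - Suc i)" using that by simp
    moreover have "x k \<le> x i" using that by (intro monotone_onD[OF assms]) auto
    ultimately show ?thesis by linarith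
  qed
  then show ?thesis unfolding vandermonde_def by (intro prod_pos) auto
qed

text \<open>
  Rows are numbered from 0, so \<open>k\<close> is addable if row \<open>k\<close> may be lengthened by one cell.
\<close>

definition addable :: "nat \<Rightarrow> (nat \<Rightarrow> nat) \<Rightarrow> nat set" where
  "addable d mu = {k. k < d \<and> (\<forall>i. k = Suc i \<longrightarrow> mu k < mu i)}"

lemma antimono_addable:
  assumes mu: "antimono_on {..<d} mu" and k: "k \<in> addable d mu"
  shows "antimono_on {..<d} (mu(k := Suc (mu k)))"
proof (rule monotone_onI)
  fix i j assume ij: "i \<in> {..<d}" "j \<in> {..<d}" "i \<le> j"
  have le: "mu q \<le> mu p" if "p \<le> q" "q < d" for p q
    using that by (intro monotone_onD[OF mu]) auto
  show "(mu(k := Suc (mu k))) j \<le> (mu(k := Suc (mu k))) i"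
  proof (cases "j = k \<and> i < k")
    case True
    then obtain p where p: "k = Suc p" "i \<le> p" by (cases k) auto
    then have "mu k < mu p" using k by (auto simp: addable_def)
    also have "mu p \<le> mu i" using le[of i p] p True ij by auto
    finally show ?thesis using True by simp
  next
    case False
    then show ?thesis using le[of i j] ij by auto
  qed
qed

text \<open>
  If a row cannot be lengthened, the raised exponent coincides with that of the row above and the
  determinant has two equal rows. Hence only partitions survive in \<open>falling_det_pieri\<close>.
\<close>

lemma shifted_schur_pieri:
  assumes x: "antimono_on {..<d} x" and mu: "antimono_on {..<d} mu"
  shows "((\<Sum>i<d. x i) - real (\<Sum>i<d. mu i)) * shifted_schur d x (row_shape d mu) =
    (\<Sum>k\<in>addable d mu. shifted_schur d x (row_shape d (mu(k := Suc (mu k)))))"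
proof -
  let ?l = "staircase d x" and ?m = "staircase_nat d mu"
  let ?V = "vandermonde d ?l"
  have sub: "addable d mu \<subseteq> {..<d}" by (auto simp: addable_def)
  have m: "?m(k := Suc (?m k)) = staircase_nat d (mu(k := Suc (mu k)))" for k by auto
  have zero: "falling_det d ?l (?m(k := Suc (?m k))) = 0" if "k < d" "k \<notin> addable d mu" for k
  proof -
    from that obtain i where i: "k = Suc i" "mu i \<le> mu k" by (auto simp: addable_def not_less)
    moreover have "mu k \<le> mu i" using i that by (intro monotone_onD[OF mu]) auto
    ultimately show ?thesis using that by (intro falling_det_repeat[of i d k]) auto
  qed
  have "(\<Sum>k\<in>addable d mu. shifted_schur d x (row_shape d (mu(k := Suc (mu k))))) * ?V =
    (\<Sum>k\<in>addable d mu. falling_det d ?l (?m(k := Suc (?m k))))"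
    unfolding sum_distrib_right m
    by (intro sum.cong refl shifted_schur_determinant antimono_addable[OF mu])
  also have "\<dots> = (\<Sum>k<d. falling_det d ?l (?m(k := Suc (?m k))))"
    by (rule sum.mono_neutral_left) (use sub zero in auto)
  also have "\<dots> = ((\<Sum>i<d. ?l i) - (\<Sum>k<d. real (?m k))) * falling_det d ?l ?m"
    by (rule falling_det_pieri)
  also have "(\<Sum>i<d. ?l i) - (\<Sum>k<d. real (?m k)) = (\<Sum>i<d. x i) - real (\<Sum>i<d. mu i)"
    by (simp only: of_nat_add of_nat_sum sum.distrib)
  also have "falling_det d ?l ?m = shifted_schur d x (row_shape d mu) * ?V"
    by (rule shifted_schur_determinant[OF mu, symmetric])
  finally have eq: "(\<Sum>k\<in>addable d mu. shifted_schur d x (row_shape d (mu(k := Suc (mu k))))) * ?V =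
    ((\<Sum>i<d. x i) - real (\<Sum>i<d. mu i)) * shifted_schur d x (row_shape d mu) * ?V"
    by (simp only: mult.assoc)
  have "?V \<noteq> 0" using vandermonde_staircase_pos[OF x] by simp
  then show ?thesis by (rule mult_right_cancel[THEN iffD1]) (rule eq[symmetric])
qed

text \<open>
  The content starts at a value at most 0 in column 1 and grows by one per step to the right, whereas
  \<open>la (d - T v)\<close> does not decrease. So the difference falls by at most one per step, and it cannot change sign
  without vanishing.
\<close>

lemma factors_positive:
  assumes S: "young S" and T: "T \<in> ssyt S d" and la: "antimono_on {..<d} la"
    and nz: "\<And>v. v \<in> S \<Longrightarrow> int (la (d - T v)) \<noteq> content v"
    and u: "(i, j) \<in> S"
  shows "content (i, j) < int (la (d - T (i, j)))"
proof -
  have ij: "1 \<le> i" "1 \<le> j" using S u by (auto simp: young_def)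
  have in_S: "(i, q) \<in> S" if "1 \<le> q" "q \<le> j" for q
    using S u ij that unfolding young_def by blast
  from ij(2) in_S show ?thesis
  proof (induction j rule: dec_induct)
    case base
    then show ?case using nz[of "(i, 1)"] ij by (auto simp: content_def)
  next
    case (step n)
    have S': "(i, n) \<in> S" "(i, n + 1) \<in> S" using step.prems[of n] step.prems[of "n+1"] step.hyps by auto
    have "T (i, n) \<le> T (i, n + 1)" using T S' unfolding ssyt_def by blast
    moreover have "1 \<le> T (i, n)" "T (i, n + 1) \<le> d" using T S' by (auto simp: ssyt_def dest: PiE_mem)
    ultimately have "la (d - T (i, n)) \<le> la (d - T (i, n + 1))"
      using T S' by (intro monotone_onD[OF la]) auto
    moreover have "content (i, n) < int (la (d - T (i, n)))" using step.IH step.prems by simp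
    ultimately show ?case using nz[OF S'(2)] by (simp add: content_def)
  qed
qed

text \<open>
  Apply positivity of all factors in the first row. A column that reaches row \<open>i\<close> forces its top entry
  to be at most \<open>d + 1 - i\<close>, so the part of \<open>la\<close> that exceeds the content \<open>j - 1\<close> of the top cell is at most that
  of row \<open>i\<close>.
\<close>

lemma shifted_schur_vanish:
  assumes S: "young S" and la: "antimono_on {..<d} la" and not: "\<not> S \<subseteq> row_shape d la"
  shows "shifted_schur d (\<lambda>i. real (la i)) S = 0"
  unfolding shifted_schur_def
proof (rule sum.neutral, rule ballI)
  fix T assume T: "T \<in> ssyt S d"
  have "finite S" using S by (simp add: young_def)
  show "weight d (\<lambda>i. real (la i)) S T = 0"
  proof (rule ccontr)
    assume "weight d (\<lambda>i. real (la i)) S T \<noteq> 0"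
    then have "real (la (d - T v)) - of_int (content v) \<noteq> 0" if "v \<in> S" for v
      using that \<open>finite S\<close> by (simp add: weight_def)
    then have nz: "int (la (d - T v)) \<noteq> content v" if "v \<in> S" for v
      using that by (metis of_int_of_nat_eq right_minus_eq)
    have "(i, j) \<in> row_shape d la" if u: "(i, j) \<in> S" for i j
    proof -
      have ij: "1 \<le> i" "1 \<le> j" using S u by (auto simp: young_def)
      then have u1: "(1, j) \<in> S" using S u unfolding young_def by blast
      have Td: "T (i, j) \<le> d" "1 \<le> T (1, j)" using T u u1 by (auto simp: ssyt_def dest: PiE_mem)
      have T1: "T (1, j) + (i - 1) \<le> T (i, j)" using ssyt_monotone[OF S T u1 u] ij by simp
      have "content (1, j) < int (la (d - T (1, j)))"
        by (rule factors_positive[OF S T la nz u1])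
      moreover have "la (d - T (1, j)) \<le> la (i - 1)"
        using T1 Td ij by (intro monotone_onD[OF la]) auto
      ultimately show ?thesis using T1 Td ij by (auto simp: row_shape_def content_def)
    qed
    with not show False by auto
  qed
qed

section \<open>The value at the shape itself and the hook lengths\<close>

text \<open>
  The falling factorial of a natural number vanishes if its length exceeds the number; with
  strictly decreasing arguments the matrix is therefore triangular.
\<close>

lemma shifted_schur_diagonal:
  assumes la: "antimono_on {..<d} la"
  shows "shifted_schur d (\<lambda>i. real (la i)) (row_shape d la) * vandermonde d (staircase d (\<lambda>i. real (la i))) =
    (\<Prod>i<d. fact (staircase_nat d la i))"
proof -
  let ?l = "staircase d (\<lambda>i. real (la i))" and ?m = "staircase_nat d la"
  have lm: "?l i = real (?m i)" for i by simp
  have lt: "?m j < ?m i" if "i < j" "j < d" for i j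
  proof -
    have "la j \<le> la i" using that by (intro monotone_onD[OF la]) auto
    then show ?thesis using that by linarith
  qed
  have "falling_det d ?l ?m = prod_list (diag_mat (mat d d (\<lambda>(k, i). falling (?l i) (?m k))))"
    unfolding falling_det_def
  proof (rule det_lower_triangular[of d])
    fix i j assume ij: "i < j" "j < d"
    have "mat d d (\<lambda>(k, i). falling (?l i) (?m k)) $$ (i, j) = falling (?l j) (?m i)"
      using ij by simp
    also have "\<dots> = falling (real (?m j)) (?m i)" unfolding lm ..
    also have "\<dots> = 0"
      unfolding falling_def
    proof (rule prod_zero)
      show "\<exists>t\<in>{..<?m i}. real (?m j) - real t = 0"
        using lt[OF ij] by (intro bexI[of _ "?m j"]) simp_all
    qed simp
    finally show "mat d d (\<lambda>(k, i). falling (?l i) (?m k)) $$ (i, j) = 0" .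
  qed simp
  also have "\<dots> = (\<Prod>i<d. falling (?l i) (?m i))"
    by (simp add: prod_list_diag_prod atLeast0LessThan)
  also have "\<dots> = (\<Prod>i<d. fact (?m i))"
  proof (rule prod.cong[OF refl])
    fix i
    have "falling (real n) n = fact n" for n
    proof -
      have "falling (real n) n = (\<Prod>t<n. real (n - t))" unfolding falling_def by (intro prod.cong) (auto simp: of_nat_diff)
      also have "\<dots> = (\<Prod>t\<in>{1..n}. real t)"
        by (rule prod.reindex_bij_witness[where i = "\<lambda>t. n - t" and j = "\<lambda>t. n - t"]) auto
      finally show ?thesis by (simp add: fact_prod)
    qed
    then show "falling (?l i) (?m i) = fact (?m i)" unfolding lm .
  qed
  finally show ?thesis using shifted_schur_determinant[OF la] by simp
qed

text \<open>
  The arm including the corner, then the leg, of the cell in row \<open>i\<close> and column \<open>j\<close> counted from 0.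
\<close>

definition hook_size :: "nat \<Rightarrow> (nat \<Rightarrow> nat) \<Rightarrow> nat \<Rightarrow> nat \<Rightarrow> nat" where
  "hook_size d la i j = la i - j + card {k \<in> {Suc i..<d}. j < la k}"

text \<open>
  The classical fact that the hook lengths in row \<open>i\<close> and the differences \<open>l\<^sub>i - l\<^sub>k\<close> for \<open>k > i\<close> partition
  the integers from 1 to \<open>l\<^sub>i\<close>. A hook length differs from \<open>l\<^sub>i - l\<^sub>k\<close> because it is larger if row \<open>k\<close>
  meets column \<open>j\<close> and smaller otherwise; then it suffices to count.
\<close>

lemma row_hooks:
  assumes la: "antimono_on {..<d} la" and i: "i < d"
  shows "(\<Prod>j<la i. hook_size d la i j) * (\<Prod>k=Suc i..<d. staircase_nat d la i - staircase_nat d la k) =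
    fact (staircase_nat d la i)"
proof -
  let ?m = "staircase_nat d la" and ?h = "hook_size d la i"
  have le: "la q \<le> la p" if "p \<le> q" "q < d" for p q
    using that by (intro monotone_onD[OF la]) auto
  \<comment> \<open>Hook lengths in row i, and differences of l_i with the later l_k.\<close>
  let ?A = "?h ` {..<la i}" and ?B = "(\<lambda>k. ?m i - ?m k) ` {Suc i..<d}"
  have fin: "finite {k \<in> {Suc i..<d}. P k}" for P by simp
  have leg: "card {k \<in> {Suc i..<d}. j < la k} \<le> card {k \<in> {Suc i..<d}. j' < la k}" if "j' \<le> j" for j j'
    using that by (intro card_mono fin) auto
  have injA: "inj_on ?h {..<la i}"
  proof (rule linorder_inj_onI')
    fix j j' assume "j \<in> {..<la i}" "j' \<in> {..<la i}" "j < j'"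
    then show "?h j \<noteq> ?h j'" using leg[of j j'] by (simp add: hook_size_def)
  qed
  have mlt: "?m k' < ?m k" if "k < k'" "k' < d" for k k'
    using le[of k k'] that by linarith
  have injB: "inj_on (\<lambda>k. ?m i - ?m k) {Suc i..<d}"
  proof (rule linorder_inj_onI')
    fix k k' assume k: "k \<in> {Suc i..<d}" "k' \<in> {Suc i..<d}" "k < k'"
    then show "?m i - ?m k \<noteq> ?m i - ?m k'" using mlt[of k k'] mlt[of i k] by auto
  qed
  have disj: "?h j \<noteq> ?m i - ?m k" if jk: "j < la i" "Suc i \<le> k" "k < d" for j k
  proof (cases "j < la k")
    case True
    have "{Suc i..k} \<subseteq> {k \<in> {Suc i..<d}. j < la k}"
      using True jk le[of _ k] by (auto intro: less_le_trans)
    from card_mono[OF fin this] have "k - i \<le> card {k \<in> {Suc i..<d}. j < la k}" by simp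
    then show ?thesis using True jk le[of i k] by (simp add: hook_size_def)
  next
    case False
    have "{k \<in> {Suc i..<d}. j < la k} \<subseteq> {Suc i..<k}"
    proof
      fix q assume q: "q \<in> {k \<in> {Suc i..<d}. j < la k}"
      then have "\<not> k \<le> q" using le[of k q] False by auto
      with q show "q \<in> {Suc i..<k}" by simp
    qed
    from card_mono[OF _ this] have "card {k \<in> {Suc i..<d}. j < la k} < k - i" using jk by simp
    then show ?thesis using False jk le[of i k] by (simp add: hook_size_def)
  qed
  have "?A \<union> ?B \<subseteq> {1..?m i}"
  proof -
    have "?h j \<le> ?m i" for j
    proof -
      have "card {k \<in> {Suc i..<d}. j < la k} \<le> card {Suc i..<d}" by (intro card_mono) auto
      then show ?thesis by (simp add: hook_size_def)
    qed
    moreover have "1 \<le> ?h j" if "j < la i" for j using that by (simp add: hook_size_def)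
    ultimately have "?A \<subseteq> {1..?m i}" by auto
    moreover have "?m i - ?m k \<in> {1..?m i}" if "k \<in> {Suc i..<d}" for k
    proof -
      have "?m k < ?m i" using that by (intro mlt) auto
      then show ?thesis unfolding atLeastAtMost_iff by linarith
    qed
    then have "?B \<subseteq> {1..?m i}" by blast
    ultimately show ?thesis by (rule Un_least)
  qed
  moreover have AB: "?A \<inter> ?B = {}" using disj by fastforce
  moreover have "card (?A \<union> ?B) = card {1..?m i}"
  proof -
    have "card (?A \<union> ?B) = card ?A + card ?B" by (rule card_Un_disjoint[OF _ _ AB]) auto
    also have "\<dots> = la i + (d - Suc i)"
      unfolding card_image[OF injA] card_image[OF injB] by simp
    finally show ?thesis by simp
  qed
  ultimately have AB_eq: "?A \<union> ?B = {1..?m i}" by (intro card_subset_eq) auto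
  have "fact (?m i) = \<Prod>(?A \<union> ?B)" unfolding AB_eq by (simp add: fact_prod)
  also have "\<dots> = \<Prod>?A * \<Prod>?B" by (rule prod.union_disjoint[OF _ _ AB]) auto
  also have "\<dots> = (\<Prod>j<la i. ?h j) * (\<Prod>k=Suc i..<d. ?m i - ?m k)"
    unfolding prod.reindex[OF injA] prod.reindex[OF injB] by (simp only: o_def)
  finally show ?thesis by simp
qed

lemma hook_product:
  assumes la: "antimono_on {..<d} la"
  shows "real (\<Prod>i<d. \<Prod>j<la i. hook_size d la i j) * vandermonde d (staircase d (\<lambda>i. real (la i))) =
    (\<Prod>i<d. fact (staircase_nat d la i))"
proof -
  have V: "vandermonde d (staircase d (\<lambda>i. real (la i))) =
      real (\<Prod>i<d. \<Prod>k=Suc i..<d. staircase_nat d la i - staircase_nat d la k)"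
    unfolding vandermonde_def of_nat_prod
  proof (intro prod.cong refl)
    fix i k assume "i \<in> {..<d}" "k \<in> {Suc i..<d}"
    moreover from this have "la k \<le> la i" by (intro monotone_onD[OF la]) auto
    ultimately show "staircase d (\<lambda>i. real (la i)) i - staircase d (\<lambda>i. real (la i)) k =
      real (staircase_nat d la i - staircase_nat d la k)" by (simp add: of_nat_diff)
  qed
  have "real ((\<Prod>i<d. \<Prod>j<la i. hook_size d la i j) *
      (\<Prod>i<d. \<Prod>k=Suc i..<d. staircase_nat d la i - staircase_nat d la k)) =
    real (\<Prod>i<d. fact (staircase_nat d la i))"
    unfolding prod.distrib[symmetric]
    by (intro arg_cong[where f = real] prod.cong refl) (simp only: row_hooks[OF la] lessThan_iff)
  then show ?thesis unfolding V by simp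
qed

lemma shifted_schur_eq_hook_product:
  assumes la: "antimono_on {..<d} la"
  shows "shifted_schur d (\<lambda>i. real (la i)) (row_shape d la) = real (\<Prod>i<d. \<Prod>j<la i. hook_size d la i j)"
proof -
  have "antimono_on {..<d} (\<lambda>i. real (la i))"
    using la by (simp add: monotone_on_def)
  from vandermonde_staircase_pos[OF this]
  have "vandermonde d (staircase d (\<lambda>i. real (la i))) \<noteq> 0" by simp
  then show ?thesis
    by (rule mult_right_cancel[THEN iffD1]) (rule trans[OF shifted_schur_diagonal[OF la] hook_product[OF la, symmetric]])
qed

section \<open>The recursion for standard tableaux\<close>

definition syt :: "cell set \<Rightarrow> (cell \<Rightarrow> nat) set" where
  "syt S = {T \<in> extensional S. bij_betw T S {1..card S} \<and>
     (\<forall>i j. (i, j) \<in> S \<and> (i, j + 1) \<in> S \<longrightarrow> T (i, j) < T (i, j + 1)) \<and>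
     (\<forall>i j. (i, j) \<in> S \<and> (i + 1, j) \<in> S \<longrightarrow> T (i, j) < T (i + 1, j))}"

text \<open>
  The cells that may carry the entry 1.
\<close>

definition minimal_cells :: "cell set \<Rightarrow> cell set" where
  "minimal_cells S = {(i, j) \<in> S. (\<forall>i'. i = i' + 1 \<longrightarrow> (i', j) \<notin> S) \<and> (\<forall>j'. j = j' + 1 \<longrightarrow> (i, j') \<notin> S)}"

lemma finite_syt:
  assumes "finite S"
  shows "finite (syt S)"
proof (rule finite_subset)
  show "syt S \<subseteq> S \<rightarrow>\<^sub>E {1..card S}" by (auto simp: syt_def PiE_def bij_betw_def)
  show "finite (S \<rightarrow>\<^sub>E {1..card S})" using assms by (intro finite_PiE) auto
qed

text \<open>
  Delete the entry 1 and lower all others by one. The inverse needs \<open>u\<close> to be minimal, as otherwise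
  a larger entry would stand to the left of or above the new entry 1.
\<close>

lemma syt_remove_one:
  assumes S: "finite S" and u: "u \<in> minimal_cells S"
  shows "bij_betw (\<lambda>T. \<lambda>v\<in>S - {u}. T v - 1) {T \<in> syt S. T u = 1} (syt (S - {u}))"
proof (rule bij_betw_byWitness[where f' = "\<lambda>T. \<lambda>v\<in>S. if v = u then 1 else T v + 1"])
  have uS: "u \<in> S" using u by (auto simp: minimal_cells_def)
  have cS: "card S = Suc (card (S - {u}))" by (rule card.remove[OF S uS])
  have gt: "1 < T v" if "T \<in> syt S" "T u = 1" "v \<in> S" "v \<noteq> u" for T v
  proof -
    have b: "bij_betw T S {1..card S}" using that by (auto simp: syt_def)
    have "T v \<noteq> T u" using b that uS by (auto simp: bij_betw_def inj_on_def)
    moreover have "1 \<le> T v" using b that by (auto simp: bij_betw_def)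
    ultimately show ?thesis using that by simp
  qed
  have arb: "T v = undefined" if "T \<in> syt R" "v \<notin> R" for T R v
    using that by (auto simp: syt_def intro: extensional_arb)
  show "\<forall>T\<in>{T \<in> syt S. T u = 1}. (\<lambda>v\<in>S. if v = u then 1 else (\<lambda>v\<in>S - {u}. T v - 1) v + 1) = T"
  proof (safe, rule ext)
    fix T v assume "T \<in> syt S" "T u = 1"
    then show "(\<lambda>v\<in>S. if v = u then 1 else (\<lambda>v\<in>S - {u}. T v - 1) v + 1) v = T v"
      using gt[of T v] arb[of T S v] by auto
  qed
  show "\<forall>T\<in>syt (S - {u}). (\<lambda>v\<in>S - {u}. (\<lambda>v\<in>S. if v = u then 1 else T v + 1) v - 1) = T"
  proof (safe, rule ext)
    fix T v assume "T \<in> syt (S - {u})"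
    then show "(\<lambda>v\<in>S - {u}. (\<lambda>v\<in>S. if v = u then 1 else T v + 1) v - 1) v = T v"
      using arb[of T "S - {u}" v] by auto
  qed
  show "(\<lambda>T. \<lambda>v\<in>S - {u}. T v - 1) ` {T \<in> syt S. T u = 1} \<subseteq> syt (S - {u})"
  proof safe
    fix T assume T: "T \<in> syt S" "T u = 1"
    have b: "bij_betw T S {1..card S}" using T by (auto simp: syt_def)
    have "T ` (S - {u}) = {1..card S} - {T u}"
      using b uS inj_on_image_set_diff[of T S S "{u}"] by (auto simp: bij_betw_def)
    then have "bij_betw T (S - {u}) ({1..card S} - {T u})"
      using b by (auto simp: bij_betw_def intro: inj_on_subset)
    moreover have "bij_betw (\<lambda>n. n - 1) ({1..card S} - {T u}) {1..card (S - {u})}"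
      by (rule bij_betw_byWitness[where f' = "\<lambda>n. n + 1"]) (auto simp: T cS)
    ultimately have "bij_betw ((\<lambda>n. n - 1) \<circ> T) (S - {u}) {1..card (S - {u})}"
      by (rule bij_betw_trans)
    then have bij: "bij_betw (\<lambda>v\<in>S - {u}. T v - 1) (S - {u}) {1..card (S - {u})}"
      by (rule bij_betw_cong[THEN iffD1, rotated]) simp
    have "(\<lambda>v\<in>S - {u}. T v - 1) v < (\<lambda>v\<in>S - {u}. T v - 1) w"
      if "v \<in> S - {u}" "w \<in> S - {u}" "T v < T w" for v w
      using that gt[OF T, of v] by auto
    then show "(\<lambda>v\<in>S - {u}. T v - 1) \<in> syt (S - {u})"
      using T(1) bij unfolding syt_def by blast
  qed
  show "(\<lambda>T. \<lambda>v\<in>S. if v = u then 1 else T v + 1) ` syt (S - {u}) \<subseteq> {T \<in> syt S. T u = 1}"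
  proof safe
    fix T assume T: "T \<in> syt (S - {u})"
    let ?T = "\<lambda>v\<in>S. if v = u then 1 else T v + 1"
    show "?T u = 1" using uS by simp
    have b: "bij_betw T (S - {u}) {1..card (S - {u})}" using T by (auto simp: syt_def)
    moreover have "bij_betw (\<lambda>n. n + 1) {1..card (S - {u})} {2..card S}"
      by (rule bij_betw_byWitness[where f' = "\<lambda>n. n - 1"]) (auto simp: cS)
    ultimately have "bij_betw ((\<lambda>n. n + 1) \<circ> T) (S - {u}) {2..card S}"
      by (rule bij_betw_trans)
    then have "bij_betw ?T (S - {u}) {2..card S}"
      by (rule bij_betw_cong[THEN iffD1, rotated]) auto
    moreover have "bij_betw ?T {u} {1}" using uS by (simp add: bij_betw_def)
    ultimately have "bij_betw ?T ((S - {u}) \<union> {u}) ({2..card S} \<union> {1})"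
      by (rule bij_betw_combine) auto
    moreover have "(S - {u}) \<union> {u} = S" using uS by auto
    moreover have "{2..card S} \<union> {1} = {1..card S}" using cS by auto
    ultimately have bij: "bij_betw ?T S {1..card S}" by simp
    have Tpos: "1 \<le> T v" if "v \<in> S" "v \<noteq> u" for v using b that by (auto simp: bij_betw_def)
    have row: "?T (i, j) < ?T (i, j + 1)" if ij: "(i, j) \<in> S" "(i, j + 1) \<in> S" for i j
    proof -
      have nu: "(i, j + 1) \<noteq> u" using u ij by (auto simp: minimal_cells_def)
      show ?thesis
      proof (cases "(i, j) = u")
        case True
        then show ?thesis using Tpos[of "(i, j + 1)"] ij nu by auto
      next
        case False
        then have "T (i, j) < T (i, j + 1)" using T ij nu unfolding syt_def by blast
        then show ?thesis using False nu ij by simp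
      qed
    qed
    have col: "?T (i, j) < ?T (i + 1, j)" if ij: "(i, j) \<in> S" "(i + 1, j) \<in> S" for i j
    proof -
      have nu: "(i + 1, j) \<noteq> u" using u ij by (auto simp: minimal_cells_def)
      show ?thesis
      proof (cases "(i, j) = u")
        case True
        then show ?thesis using Tpos[of "(i + 1, j)"] ij nu by auto
      next
        case False
        then have "T (i, j) < T (i + 1, j)" using T ij nu unfolding syt_def by blast
        then show ?thesis using False nu ij by simp
      qed
    qed
    show "?T \<in> syt S" using bij row col unfolding syt_def by (simp add: restrict_extensional)
  qed
qed

text \<open>
  The entry 1 sits in exactly one cell, and this cell is minimal.
\<close>

lemma card_syt_recursion:
  assumes S: "finite S" "S \<noteq> {}"
  shows "card (syt S) = (\<Sum>u\<in>minimal_cells S. card (syt (S - {u})))"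
proof -
  have fin: "finite (minimal_cells S)"
    by (rule finite_subset[OF _ S(1)]) (auto simp: minimal_cells_def)
  have "syt S = (\<Union>u\<in>minimal_cells S. {T \<in> syt S. T u = 1})"
  proof -
    have "\<exists>u\<in>minimal_cells S. T u = 1" if T: "T \<in> syt S" for T
    proof -
      have b: "bij_betw T S {1..card S}" using T by (auto simp: syt_def)
      have "1 \<in> {1..card S}" using S by (simp add: Suc_le_eq card_gt_0_iff)
      then obtain u where u: "u \<in> S" "T u = 1" using b by (metis bij_betw_imp_surj_on imageE)
      have pos: "1 \<le> T v" if "v \<in> S" for v using b that by (auto simp: bij_betw_def)
      have "(i, j') \<notin> S" if "u = (i, j' + 1)" for i j'
        using T u pos[of "(i, j')"] that by (fastforce simp: syt_def)
      moreover have "(i', j) \<notin> S" if "u = (i' + 1, j)" for i' j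
        using T u pos[of "(i', j)"] that by (fastforce simp: syt_def)
      ultimately have "u \<in> minimal_cells S" using u by (cases u) (auto simp: minimal_cells_def)
      with u show ?thesis by blast
    qed
    then show ?thesis by blast
  qed
  moreover have "card (\<Union>u\<in>minimal_cells S. {T \<in> syt S. T u = 1}) =
      (\<Sum>u\<in>minimal_cells S. card {T \<in> syt S. T u = 1})"
  proof (rule card_UN_disjoint[OF fin])
    show "\<forall>u\<in>minimal_cells S. finite {T \<in> syt S. T u = 1}" using finite_syt[OF S(1)] by simp
    have "u = v" if "T \<in> syt S" "u \<in> S" "v \<in> S" "T u = 1" "T v = 1" for T u v
    proof (rule inj_onD)
      show "inj_on T S" using that(1) by (auto simp: syt_def bij_betw_def)
    qed (use that in simp_all)
    then show "\<forall>u\<in>minimal_cells S. \<forall>v\<in>minimal_cells S. u \<noteq> v \<longrightarrow>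
        {T \<in> syt S. T u = 1} \<inter> {T \<in> syt S. T v = 1} = {}"
      unfolding minimal_cells_def by blast
  qed
  moreover have "\<dots> = (\<Sum>u\<in>minimal_cells S. card (syt (S - {u})))"
    by (intro sum.cong refl bij_betw_same_card[OF syt_remove_one[OF S(1)]])
  ultimately show ?thesis by simp
qed

section \<open>The Okounkov--Olshanski formula\<close>

lemma minimal_cells_skew:
  assumes la: "antimono_on {..<d} la" and mu: "antimono_on {..<d} mu"
  shows "minimal_cells (row_shape d la - row_shape d mu) =
    (\<lambda>k. (Suc k, Suc (mu k))) ` {k \<in> addable d mu. mu k < la k}"
proof (rule Set.set_eqI, rule iffI)
  fix u assume "u \<in> minimal_cells (row_shape d la - row_shape d mu)"
  then obtain i j where u: "u = (i, j)" "(i, j) \<in> row_shape d la" "(i, j) \<notin> row_shape d mu"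
    and min: "\<And>i'. i = i' + 1 \<Longrightarrow> (i', j) \<notin> row_shape d la - row_shape d mu"
      "\<And>j'. j = j' + 1 \<Longrightarrow> (i, j') \<notin> row_shape d la - row_shape d mu"
    unfolding minimal_cells_def by auto
  obtain k q where kq: "i = Suc k" "j = Suc q" using u(2) by (cases i; cases j) (auto simp: row_shape_def)
  have k: "k < d" "q < la k" "mu k \<le> q" using u kq by (auto simp: row_shape_def)
  have "q = mu k" using min(2)[of q] kq k by (cases q) (auto simp: row_shape_def)
  moreover have "mu k < mu p" if p: "k = Suc p" for p
  proof -
    have "la k \<le> la p" using p k by (intro monotone_onD[OF la]) auto
    then show ?thesis using min(1)[of k] kq k p by (auto simp: row_shape_def)
  qed
  ultimately show "u \<in> (\<lambda>k. (Suc k, Suc (mu k))) ` {k \<in> addable d mu. mu k < la k}"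
    using u(1) kq k by (auto simp: addable_def)
next
  fix u assume "u \<in> (\<lambda>k. (Suc k, Suc (mu k))) ` {k \<in> addable d mu. mu k < la k}"
  then obtain k where k: "u = (Suc k, Suc (mu k))" "k < d" "mu k < la k"
    and add: "\<And>p. k = Suc p \<Longrightarrow> mu k < mu p" by (auto simp: addable_def)
  have "(k, Suc (mu k)) \<notin> row_shape d la - row_shape d mu"
    using add[of "k - 1"] k by (cases k) (auto simp: row_shape_def)
  then show "u \<in> minimal_cells (row_shape d la - row_shape d mu)"
    using k by (auto simp: minimal_cells_def row_shape_def)
qed

lemma skew_add_cell:
  "k < d \<Longrightarrow> row_shape d la - row_shape d mu - {(Suc k, Suc (mu k))} =
    row_shape d la - row_shape d (mu(k := Suc (mu k)))"
  by (auto simp: row_shape_def le_Suc_eq split: if_splits)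

text \<open>
  Induction on the number of cells of the skew shape. Both sides obey the recursion over the shapes obtained
  from \<open>mu\<close> by adding a cell; on the side of the shifted Schur functions it also runs over shapes outside
  \<open>la\<close>, whose terms vanish.
\<close>

theorem okounkov_olshanski:
  assumes la: "antimono_on {..<d} la" and mu: "antimono_on {..<d} mu"
    and le: "\<And>i. i < d \<Longrightarrow> mu i \<le> la i"
  shows "real (card (syt (row_shape d la - row_shape d mu))) * real (\<Prod>i<d. \<Prod>j<la i. hook_size d la i j) =
    fact (card (row_shape d la - row_shape d mu)) * shifted_schur d (\<lambda>i. real (la i)) (row_shape d mu)"
  using mu le
proof (induction "card (row_shape d la - row_shape d mu)" arbitrary: mu)
  case 0
  then have "row_shape d la \<subseteq> row_shape d mu" by simp
  have "mu i = la i" if "i < d" for i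
  proof -
    have "la i \<le> mu i" if "0 < la i"
    proof -
      have "(Suc i, la i) \<in> row_shape d la" using that \<open>i < d\<close> by (auto simp: row_shape_def)
      then have "(Suc i, la i) \<in> row_shape d mu" using \<open>row_shape d la \<subseteq> row_shape d mu\<close> by blast
      then show ?thesis by (simp add: row_shape_def)
    qed
    then show ?thesis using 0(3)[OF that] by (cases "0 < la i") auto
  qed
  then have eq: "row_shape d mu = row_shape d la" by (auto simp: row_shape_def)
  have "syt {} = {\<lambda>_. undefined}" by (auto simp: syt_def bij_betw_def)
  then show ?case by (simp add: eq shifted_schur_eq_hook_product[OF la])
next
  case (Suc n)
  let ?S = "row_shape d la - row_shape d mu" and ?mu = "\<lambda>k. mu(k := Suc (mu k))"
  let ?F = "\<lambda>m. shifted_schur d (\<lambda>i. real (la i)) (row_shape d m)"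
  let ?H = "real (\<Prod>i<d. \<Prod>j<la i. hook_size d la i j)"
  let ?K = "{k \<in> addable d mu. mu k < la k}"
  have add: "k < d" if "k \<in> addable d mu" for k using that by (simp add: addable_def)
  have finK: "finite (addable d mu)" by (rule finite_subset[of _ "{..<d}"]) (auto dest: add)
  have sub: "row_shape d mu \<subseteq> row_shape d la"
  proof
    fix u assume "u \<in> row_shape d mu"
    then show "u \<in> row_shape d la"
      using Suc.prems(2)[of "fst u - 1"] by (cases u; cases "fst u") (auto simp: row_shape_def)
  qed
  have cS: "card ?S = (\<Sum>i<d. la i) - (\<Sum>i<d. mu i)"
    using card_Diff_subset[OF finite_row_shape sub] by (simp add: card_row_shape)
  have n: "real (Suc n) = (\<Sum>i<d. real (la i)) - real (\<Sum>i<d. mu i)"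
    using Suc.hyps(2) cS by (simp add: of_nat_diff)
  have S: "finite ?S" by simp
  have S': "?S \<noteq> {}" using Suc.hyps(2) by (metis card.empty nat.distinct(1))
  have skew: "?S - {(Suc k, Suc (mu k))} = row_shape d la - row_shape d (?mu k)" if "k \<in> ?K" for k
    using that add by (intro skew_add_cell) auto
  have IH: "real (card (syt (?S - {(Suc k, Suc (mu k))}))) * ?H = fact n * ?F (?mu k)" if k: "k \<in> ?K" for k
  proof -
    have "(Suc k, Suc (mu k)) \<in> ?S" using k add[of k] by (auto simp: row_shape_def)
    then have "card (?S - {(Suc k, Suc (mu k))}) = n" using Suc.hyps(2) by (simp del: Diff_iff)
    then have n_eq: "n = card (row_shape d la - row_shape d (?mu k))" by (simp only: skew[OF k])
    from n_eq have "n = card (row_shape d la - row_shape d (?mu k))" .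
    moreover have "antimono_on {..<d} (?mu k)" using k by (intro antimono_addable[OF Suc.prems(1)]) simp
    moreover have "(?mu k) i \<le> la i" if "i < d" for i using k Suc.prems(2)[OF that] by simp
    ultimately have "real (card (syt (row_shape d la - row_shape d (?mu k)))) * ?H =
        fact (card (row_shape d la - row_shape d (?mu k))) * ?F (?mu k)"
      by (rule Suc.hyps(1))
    then show ?thesis unfolding skew[OF k] n_eq[symmetric] .
  qed
  have vanish: "?F (?mu k) = 0" if k: "k \<in> addable d mu" "\<not> mu k < la k" for k
  proof (rule shifted_schur_vanish[OF young_row_shape la])
    show "antimono_on {..<d} (?mu k)" by (rule antimono_addable[OF Suc.prems(1) k(1)])
    have "(Suc k, Suc (mu k)) \<in> row_shape d (?mu k) - row_shape d la"
      using k add[of k] by (auto simp: row_shape_def)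
    then show "\<not> row_shape d (?mu k) \<subseteq> row_shape d la" by blast
  qed
  have "card (syt ?S) = (\<Sum>k\<in>?K. card (syt (?S - {(Suc k, Suc (mu k))})))"
    unfolding card_syt_recursion[OF S S'] minimal_cells_skew[OF la Suc.prems(1)]
    by (subst sum.reindex) (auto simp: inj_on_def)
  then have "real (card (syt ?S)) * ?H = (\<Sum>k\<in>?K. fact n * ?F (?mu k))"
    by (simp only: of_nat_sum sum_distrib_right) (intro sum.cong refl IH)
  also have "\<dots> = (\<Sum>k\<in>addable d mu. fact n * ?F (?mu k))"
    by (rule sum.mono_neutral_left[OF finK]) (auto simp: vanish)
  also have "\<dots> = fact n * (real (Suc n) * ?F mu)"
  proof -
    have "antimono_on {..<d} (\<lambda>i. real (la i))"
      using la by (simp add: monotone_on_def)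
    from shifted_schur_pieri[OF this Suc.prems(1)] show ?thesis
      by (simp only: n sum_distrib_left[symmetric])
  qed
  also have "\<dots> = fact (card ?S) * ?F mu" by (simp flip: Suc.hyps(2))
  finally show ?case .
qed

section \<open>Excited diagrams and semistandard tableaux\<close>

text \<open>
  Where \<open>u\<close> ends up if it is moved along its diagonal to row \<open>T u\<close>. The subtraction does not truncate since
  entries are at least their row number (\<open>ssyt_ge_fst\<close>).
\<close>

definition placement :: "cell set \<Rightarrow> (cell \<Rightarrow> nat) \<Rightarrow> cell \<Rightarrow> cell" where
  "placement S T = (\<lambda>u\<in>S. (T u, T u + snd u - fst u))"

lemma ssyt_ge_fst: "young S \<Longrightarrow> T \<in> ssyt S d \<Longrightarrow> u \<in> S \<Longrightarrow> fst u \<le> T u"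
  using ssyt_ge_row[of S T d "fst u" "snd u"] by simp

lemma content_placement:
  assumes "young S" "T \<in> ssyt S d" "u \<in> S"
  shows "content (placement S T u) = content u"
  using ssyt_ge_fst[OF assms] assms(3) by (simp add: placement_def content_def)

lemma placement_eq_iff:
  assumes S: "young S" and T: "T \<in> ssyt S d" "T' \<in> ssyt S d" and "u \<in> S" "v \<in> S"
  shows "placement S T u = placement S T' v \<longleftrightarrow> T u = T' v \<and> content u = content v"
proof
  assume eq: "placement S T u = placement S T' v"
  then have "T u = T' v" using assms by (simp add: placement_def)
  moreover have "content u = content v"
    using content_placement[OF S T(1) \<open>u \<in> S\<close>] content_placement[OF S T(2) \<open>v \<in> S\<close>] eq by simp
  ultimately show "T u = T' v \<and> content u = content v" by simp
next
  assume *: "T u = T' v \<and> content u = content v"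
  then have "T u + snd u - fst u = T' v + snd v - fst v"
    using ssyt_ge_fst[OF S T(1) \<open>u \<in> S\<close>] ssyt_ge_fst[OF S T(2) \<open>v \<in> S\<close>]
    unfolding content_def by linarith
  then show "placement S T u = placement S T' v" using * assms by (simp add: placement_def)
qed

lemma diagonal_less:
  assumes S: "young S" and T: "T \<in> ssyt S d" and uv: "u \<in> S" "v \<in> S" "content u = content v"
  shows "T u < T v \<longleftrightarrow> fst u < fst v"
proof -
  have less: "T a < T b" if ab: "a \<in> S" "b \<in> S" "content a = content b" "fst a < fst b" for a b
  proof -
    have "snd a \<le> snd b" using ab by (simp add: content_def)
    then have "T (fst a, snd a) + (fst b - fst a) \<le> T (fst b, snd b)"
      using ab by (intro ssyt_monotone[OF S T]) auto
    then show ?thesis using ab by simp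
  qed
  have "u = v" if "fst u = fst v" using that uv(3) by (simp add: content_def prod_eq_iff)
  with less[of u v] less[of v u] uv show ?thesis by (metis less_asym linorder_neqE_nat)
qed

lemma inj_on_placement:
  assumes S: "young S" and T: "T \<in> ssyt S d"
  shows "inj_on (placement S T) S"
proof (rule inj_onI)
  fix u v assume uv: "u \<in> S" "v \<in> S" "placement S T u = placement S T v"
  then have *: "T u = T v" "content u = content v" using placement_eq_iff[OF S T T] by auto
  then have "fst u = fst v"
    using diagonal_less[OF S T, of u v] diagonal_less[OF S T, of v u] uv by simp
  with *(2) show "u = v" by (simp add: content_def prod_eq_iff)
qed

text \<open>
  On each diagonal the entries increase strictly, so the set of occupied rows determines them. The proof goes down
  the diagonals: if \<open>A u < B u\<close> for a topmost cell \<open>u\<close>, then the position of \<open>u\<close> under \<open>A\<close> is taken under \<open>B\<close> by an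
  earlier cell of the diagonal, where \<open>A\<close> and \<open>B\<close> agree, and \<open>A\<close> would repeat an entry on the diagonal.
\<close>

lemma placement_image_inj:
  assumes S: "young S" and T: "T \<in> ssyt S d" "T' \<in> ssyt S d"
    and eq: "placement S T ` S = placement S T' ` S"
  shows "T = T'"
proof -
  \<comment> \<open>Stated for two generic tableaux, because it is applied to T and T' in both orders.\<close>
  have not_less: "\<not> A u < B u"
    if AB: "A \<in> ssyt S d" "B \<in> ssyt S d" "placement S A ` S = placement S B ` S"
      and u: "u \<in> S" and IH: "\<And>v. v \<in> S \<Longrightarrow> fst v < fst u \<Longrightarrow> A v = B v" for A B u
  proof
    assume less: "A u < B u"
    have "placement S A u \<in> placement S B ` S" using u AB(3) by blast
    then obtain v where v: "v \<in> S" "placement S A u = placement S B v" by blast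
    then have Bv: "A u = B v" "content u = content v" using placement_eq_iff[OF S AB(1,2) u] by auto
    then have "fst v < fst u" using diagonal_less[OF S AB(2) v(1) u] less by simp
    with IH[OF v(1)] diagonal_less[OF S AB(1) v(1) u] Bv show False by simp
  qed
  have "T u = T' u" if "u \<in> S" for u
    using that
  proof (induction "fst u" arbitrary: u rule: less_induct)
    case less
    then have IH: "T v = T' v" if "v \<in> S" "fst v < fst u" for v using that by simp
    have "\<not> T u < T' u" by (rule not_less[OF T eq less.prems IH])
    moreover have "\<not> T' u < T u" by (rule not_less[OF T(2,1) eq[symmetric] less.prems IH[symmetric]])
    ultimately show ?case by simp
  qed
  moreover have "T \<in> extensional S" "T' \<in> extensional S" using T by (auto simp: ssyt_def PiE_def)
  ultimately show ?thesis by (intro extensionalityI) auto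
qed

text \<open>
  If raising the entry at \<open>u\<close> violated the row or the column condition, the neighbour to the right or below would
  occupy the position right of or below the current position of \<open>u\<close>.
\<close>

lemma excitable_imp_ssyt:
  assumes S: "young S" and T: "T \<in> ssyt S d" and u: "u \<in> S"
    and ex: "excitable d (placement S T ` S) (placement S T u)"
  shows "T(u := Suc (T u)) \<in> ssyt S d"
proof -
  obtain i j where ij: "u = (i, j)" by (cases u)
  have ge: "i \<le> T (i, j)" using ssyt_ge_row[OF S T] u ij by simp
  have pl: "placement S T u = (T (i, j), T (i, j) + j - i)" using u ij by (simp add: placement_def)
  have bound: "Suc (T (i, j)) \<le> d"
    and free_down: "(T (i, j) + 1, T (i, j) + j - i) \<notin> placement S T ` S"
    and free_right: "(T (i, j), T (i, j) + j - i + 1) \<notin> placement S T ` S"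
    using ex unfolding pl excitable_def by (auto simp: region_def)
  have row: "T (i, j) < T (i, j + 1)" if "(i, j + 1) \<in> S"
  proof -
    have "T (i, j) \<le> T (i, j + 1)" using T u ij that unfolding ssyt_def by blast
    moreover have "T (i, j + 1) \<noteq> T (i, j)"
    proof
      assume "T (i, j + 1) = T (i, j)"
      then have "placement S T (i, j + 1) = (T (i, j), T (i, j) + j - i + 1)"
        using that ge by (simp add: placement_def)
      with free_right that show False by (metis imageI)
    qed
    ultimately show ?thesis by simp
  qed
  have col: "Suc (T (i, j)) < T (i + 1, j)" if "(i + 1, j) \<in> S"
  proof -
    have "T (i, j) < T (i + 1, j)" using T u ij that unfolding ssyt_def by blast
    moreover have "T (i + 1, j) \<noteq> Suc (T (i, j))"
    proof
      assume "T (i + 1, j) = Suc (T (i, j))"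
      then have "placement S T (i + 1, j) = (T (i, j) + 1, T (i, j) + j - i)"
        using that ge by (simp add: placement_def)
      with free_down that show False by (metis imageI)
    qed
    ultimately show ?thesis by simp
  qed
  let ?T = "T(u := Suc (T u))"
  have mem: "?T \<in> S \<rightarrow>\<^sub>E {1..d}"
    using T u bound ij by (auto simp: ssyt_def PiE_iff extensional_def)
  have rows: "?T (p, q) \<le> ?T (p, q + 1)" if pq: "(p, q) \<in> S" "(p, q + 1) \<in> S" for p q
  proof -
    have "T (p, q) \<le> T (p, q + 1)" using T pq unfolding ssyt_def by blast
    then show ?thesis using row pq ij by (cases "(p, q) = u"; cases "(p, q + 1) = u") auto
  qed
  have cols: "?T (p, q) < ?T (p + 1, q)" if pq: "(p, q) \<in> S" "(p + 1, q) \<in> S" for p q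
  proof -
    have "T (p, q) < T (p + 1, q)" using T pq unfolding ssyt_def by blast
    then show ?thesis using col pq ij by (cases "(p, q) = u"; cases "(p + 1, q) = u") auto
  qed
  show ?thesis using mem rows cols unfolding ssyt_def by blast
qed

text \<open>
  A cell occupying one of the three positions next to \<open>u\<close> lies on the same or on an adjacent diagonal, so it is
  comparable with \<open>u\<close> in the order of cells. If it comes before \<open>u\<close>, monotonicity of \<open>T\<close> makes
  its entry too small for that position; if it comes after \<open>u\<close>, monotonicity of the raised tableau makes it too large.
\<close>

lemma ssyt_imp_excitable:
  assumes S: "young S" and T: "T \<in> ssyt S d" and u: "u \<in> S"
    and T': "T(u := Suc (T u)) \<in> ssyt S d"
  shows "excitable d (placement S T ` S) (placement S T u)"
proof -
  obtain i j where ij: "u = (i, j)" by (cases u)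
  let ?T = "T(u := Suc (T u))"
  have pos: "1 \<le> i" "1 \<le> j" using S u ij by (auto simp: young_def)
  have ge: "i \<le> T (i, j)" using ssyt_ge_row[OF S T] u ij by simp
  have "?T u \<in> {1..d}" using T' u unfolding ssyt_def by (blast dest: PiE_mem)
  then have bound: "Suc (T (i, j)) \<le> d" using ij by simp
  have pl: "placement S T u = (T (i, j), T (i, j) + j - i)" using u ij by (simp add: placement_def)
  have before: "T (p, q) + (i - p) \<le> T (i, j)" if "(p, q) \<in> S" "p \<le> i" "q \<le> j" for p q
    using ssyt_monotone[OF S T that(1), of i j] that u ij by simp
  have after: "Suc (T (i, j)) + (p - i) \<le> T (p, q)" if "(p, q) \<in> S" "i \<le> p" "j \<le> q" "(p, q) \<noteq> u" for p q
    using ssyt_monotone[OF S T' _ that(1), of i j] that u ij by (auto split: if_splits)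
  have "(T (i, j) + 1, T (i, j) + j - i) \<notin> placement S T ` S"
  proof
    assume "(T (i, j) + 1, T (i, j) + j - i) \<in> placement S T ` S"
    then obtain p q where pq: "(p, q) \<in> S" "T (p, q) = T (i, j) + 1" "T (i, j) + 1 + q - p = T (i, j) + j - i"
      by (auto simp: placement_def)
    have "p \<le> T (p, q)" by (rule ssyt_ge_row[OF S T pq(1)])
    then have "int q - int p = int j - int i - 1" using pq(2,3) ge by linarith
    then show False using before[OF pq(1)] after[OF pq(1)] pq(2) ij by (cases "p \<le> i") auto
  qed
  moreover have "(T (i, j), T (i, j) + j - i + 1) \<notin> placement S T ` S"
  proof
    assume "(T (i, j), T (i, j) + j - i + 1) \<in> placement S T ` S"
    then obtain p q where pq: "(p, q) \<in> S" "T (p, q) = T (i, j)" "T (i, j) + q - p = T (i, j) + j - i + 1"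
      by (auto simp: placement_def)
    have "p \<le> T (p, q)" by (rule ssyt_ge_row[OF S T pq(1)])
    then have "int q - int p = int j - int i + 1" using pq(2,3) ge by linarith
    then show False using before[OF pq(1)] after[OF pq(1)] pq(2) ij by (cases "i \<le> p") auto
  qed
  moreover have "(T (i, j) + 1, T (i, j) + j - i + 1) \<notin> placement S T ` S"
  proof
    assume "(T (i, j) + 1, T (i, j) + j - i + 1) \<in> placement S T ` S"
    then obtain p q where pq: "(p, q) \<in> S" "T (p, q) = T (i, j) + 1" "T (i, j) + 1 + q - p = T (i, j) + j - i + 1"
      by (auto simp: placement_def)
    have "p \<le> T (p, q)" by (rule ssyt_ge_row[OF S T pq(1)])
    then have "int q - int p = int j - int i" using pq(2,3) ge by linarith
    then show False using before[OF pq(1)] after[OF pq(1)] pq(2) ij by (cases "p \<le> i") auto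
  qed
  moreover have "(T (i, j), T (i, j) + j - i) \<in> placement S T ` S" using u pl by (metis imageI)
  ultimately show ?thesis
    using bound pos ge unfolding excitable_def pl by (auto simp: region_def)
qed

lemma placement_shift:
  assumes "young S" "T \<in> ssyt S d" "u \<in> S"
  shows "(placement S T)(u := shift (placement S T u)) = placement S (T(u := Suc (T u)))"
  using ssyt_ge_fst[OF assms] assms(3)
  by (auto simp: placement_def shift_def fun_eq_iff Suc_diff_le)

lemma rows_ssyt:
  assumes S: "young S" "\<forall>u\<in>S. fst u \<le> d"
  shows "restrict fst S \<in> ssyt S d" "placement S (restrict fst S) = restrict (\<lambda>u. u) S"
  using S by (fastforce simp: ssyt_def young_def, auto simp: placement_def fun_eq_iff)

text \<open>
  Among the cells whose entry exceeds the row number choose one with the least sum of coordinates. Its left and upper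
  neighbours still have their least possible entries, so its own entry may be lowered.
\<close>

lemma ssyt_unexcite:
  assumes S: "young S" and T: "T \<in> ssyt S d" and ne: "T \<noteq> restrict fst S"
  obtains u where "u \<in> S" "fst u < T u" "T(u := T u - 1) \<in> ssyt S d"
proof -
  have ext: "T \<in> extensional S" using T by (simp add: ssyt_def PiE_def)
  have "\<exists>u. u \<in> S \<and> fst u < T u"
  proof (rule ccontr)
    assume "\<not> ?thesis"
    then have "T u = fst u" if "u \<in> S" for u using ssyt_ge_fst[OF S T that] that by fastforce
    then have "T = restrict fst S" by (intro extensionalityI[OF ext restrict_extensional]) simp
    with ne show False ..
  qed
  then obtain u0 where "u0 \<in> S \<and> fst u0 < T u0" ..
  from ex_has_least_nat[of "\<lambda>u. u \<in> S \<and> fst u < T u" u0 "\<lambda>u. fst u + snd u", OF this]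
  obtain u where u: "u \<in> S" "fst u < T u"
    and least: "\<And>v. v \<in> S \<Longrightarrow> fst v < T v \<Longrightarrow> fst u + snd u \<le> fst v + snd v" by blast
  have before: "T v = fst v" if "v \<in> S" "fst v + snd v < fst u + snd u" for v
    using least[OF that(1)] that(2) ssyt_ge_fst[OF S T that(1)] by fastforce
  let ?T = "T(u := T u - 1)"
  have mem: "?T \<in> S \<rightarrow>\<^sub>E {1..d}"
  proof (rule PiE_I)
    fix v assume v: "v \<in> S"
    have "T v \<in> {1..d}" using T v unfolding ssyt_def by (blast dest: PiE_mem)
    moreover have "1 \<le> fst u" using S u(1) by (auto simp: young_def)
    ultimately show "?T v \<in> {1..d}" using u(2) by auto
  next
    fix v assume "v \<notin> S"
    then show "?T v = undefined" using u(1) extensional_arb[OF ext] by auto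
  qed
  have rows: "?T (p, q) \<le> ?T (p, q + 1)" if pq: "(p, q) \<in> S" "(p, q + 1) \<in> S" for p q
  proof (cases "(p, q + 1) = u")
    case True
    then have "T (p, q) = p" using before[of "(p, q)"] pq by auto
    then show ?thesis using True u(2) by auto
  next
    case False
    have "T (p, q) \<le> T (p, q + 1)" using T pq unfolding ssyt_def by blast
    then show ?thesis using False by auto
  qed
  have cols: "?T (p, q) < ?T (p + 1, q)" if pq: "(p, q) \<in> S" "(p + 1, q) \<in> S" for p q
  proof (cases "(p + 1, q) = u")
    case True
    then have "T (p, q) = p" using before[of "(p, q)"] pq by auto
    then show ?thesis using True u(2) by auto
  next
    case False
    have "T (p, q) < T (p + 1, q)" using T pq unfolding ssyt_def by blast
    then show ?thesis using False by auto
  qed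
  have "?T \<in> ssyt S d" using mem rows cols unfolding ssyt_def by blast
  with u show thesis by (rule that)
qed

text \<open>
  Placements are generated from tableaux by legal increments; conversely \<open>ssyt_unexcite\<close> undoes an
  increment, and the sum of the entries decreases.
\<close>

lemma excited_placements_eq:
  assumes S: "young (diagram mu)" "\<forall>u\<in>diagram mu. fst u \<le> d"
  shows "excited_placements d mu = placement (diagram mu) ` ssyt (diagram mu) d"
proof
  let ?S = "diagram mu"
  show "excited_placements d mu \<subseteq> placement ?S ` ssyt ?S d"
  proof
    fix g assume "g \<in> excited_placements d mu"
    then show "g \<in> placement ?S ` ssyt ?S d"
    proof induction
      case start
      then show ?case using rows_ssyt[OF S] by (metis imageI)
    next
      case (move g u)
      then obtain T where T: "g = placement ?S T" "T \<in> ssyt ?S d" by blast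
      have "T(u := Suc (T u)) \<in> ssyt ?S d"
        using excitable_imp_ssyt[OF S(1) T(2) move.hyps(2)] move.hyps(3) unfolding T(1) .
      then show ?case unfolding T(1) placement_shift[OF S(1) T(2) move.hyps(2)] by (rule imageI)
    qed
  qed
  have "placement ?S T \<in> excited_placements d mu" if "T \<in> ssyt ?S d" for T
    using that
  proof (induction "\<Sum>u\<in>?S. T u" arbitrary: T rule: less_induct)
    case less
    show ?case
    proof (cases "T = restrict fst ?S")
      case True
      then show ?thesis using rows_ssyt(2)[OF S] excited_placements.start by metis
    next
      case False
      then obtain u where u: "u \<in> ?S" "fst u < T u" "T(u := T u - 1) \<in> ssyt ?S d"
        using ssyt_unexcite[OF S(1) less.prems] by metis
      let ?T = "T(u := T u - 1)"
      have fin: "finite ?S" using S(1) by (simp add: young_def)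
      have T: "?T(u := Suc (?T u)) = T" using u(2) by auto
      have "(\<Sum>v\<in>?S. ?T v) < (\<Sum>v\<in>?S. T v)"
        by (rule sum_strict_mono_ex1[OF fin]) (use u in auto)
      from less.hyps[OF this u(3)] have "placement ?S ?T \<in> excited_placements d mu" .
      moreover have "excitable d (placement ?S ?T ` ?S) (placement ?S ?T u)"
        by (rule ssyt_imp_excitable[OF S(1) u(3,1)]) (simp only: T less.prems)
      ultimately have "(placement ?S ?T)(u := shift (placement ?S ?T u)) \<in> excited_placements d mu"
        by (rule excited_placements.move[OF _ u(1)])
      then show ?thesis unfolding placement_shift[OF S(1) u(3,1)] T .
    qed
  qed
  then show "placement ?S ` ssyt ?S d \<subseteq> excited_placements d mu" by blast
qed

text \<open>
  Every move of a diagram lifts to a move of a placement, because placements are injective.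
\<close>

lemma excited_diagrams_eq_placements:
  assumes S: "young (diagram mu)" "\<forall>u\<in>diagram mu. fst u \<le> d"
  shows "excited_diagrams d mu = (\<lambda>g. g ` diagram mu) ` excited_placements d mu"
proof
  let ?S = "diagram mu"
  have moved: "(g(u := shift (g u))) ` ?S = insert (shift (g u)) (g ` ?S - {g u})"
    if g: "g \<in> excited_placements d mu" and u: "u \<in> ?S" for g u
  proof -
    have "inj_on g ?S" using g inj_on_placement[OF S(1)] unfolding excited_placements_eq[OF S] by auto
    then have "g ` (?S - {u}) = g ` ?S - {g u}" using u by (auto simp: inj_on_def)
    moreover have "(g(u := shift (g u))) ` ?S = insert (shift (g u)) (g ` (?S - {u}))"
      using u by auto
    ultimately show ?thesis by simp
  qed
  show "excited_diagrams d mu \<subseteq> (\<lambda>g. g ` ?S) ` excited_placements d mu"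
  proof
    fix D assume "D \<in> excited_diagrams d mu"
    then show "D \<in> (\<lambda>g. g ` ?S) ` excited_placements d mu"
    proof induction
      case start
      have "restrict (\<lambda>u. u) ?S ` ?S = ?S" by auto
      then show ?case using excited_placements.start by (metis imageI)
    next
      case (move D v)
      then obtain g where g: "D = g ` ?S" "g \<in> excited_placements d mu" by blast
      have "v \<in> g ` ?S" using move.hyps(2) g(1) by (simp add: excitable_def)
      then obtain u where u: "u \<in> ?S" "v = g u" by blast
      have "g(u := shift (g u)) \<in> excited_placements d mu"
        using excited_placements.move[OF g(2) u(1)] move.hyps(2) g(1) u(2) by simp
      moreover have "insert (shift v) (D - {v}) = (g(u := shift (g u))) ` ?S"
        unfolding moved[OF g(2) u(1)] g(1) u(2) ..
      ultimately show ?case by (metis imageI)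
    qed
  qed
  have "g ` ?S \<in> excited_diagrams d mu" if "g \<in> excited_placements d mu" for g
    using that
  proof induction
    case start
    have "restrict (\<lambda>u. u) ?S ` ?S = ?S" by auto
    then show ?case using excited_diagrams.start by metis
  next
    case (move g u)
    show ?case unfolding moved[OF move.hyps(1,2)]
      by (rule excited_diagrams.move[OF move.IH move.hyps(3)])
  qed
  then show "(\<lambda>g. g ` ?S) ` excited_placements d mu \<subseteq> excited_diagrams d mu" by blast
qed

lemma phi_placement:
  assumes S: "young (diagram mu)" "\<forall>u\<in>diagram mu. fst u \<le> d" and T: "T \<in> ssyt (diagram mu) d"
  shows "phi d mu (placement (diagram mu) T ` diagram mu) = T"
proof -
  let ?S = "diagram mu"
  have fst: "restrict (\<lambda>u. fst (placement ?S A u)) ?S = A" if "A \<in> ssyt ?S d" for A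
  proof (rule extensionalityI)
    show "A \<in> extensional ?S" using that by (simp add: ssyt_def PiE_def)
  qed (simp_all add: placement_def)
  show ?thesis
    unfolding phi_def
  proof (rule the_equality)
    show "\<exists>g\<in>excited_placements d mu. g ` ?S = placement ?S T ` ?S \<and> T = restrict (\<lambda>u. fst (g u)) ?S"
      unfolding excited_placements_eq[OF S] using T fst[OF T] by (intro bexI[of _ "placement ?S T"]) auto
  next
    fix A assume "\<exists>g\<in>excited_placements d mu. g ` ?S = placement ?S T ` ?S \<and> A = restrict (\<lambda>u. fst (g u)) ?S"
    then obtain B where B: "B \<in> ssyt ?S d" "placement ?S B ` ?S = placement ?S T ` ?S"
      "A = restrict (\<lambda>u. fst (placement ?S B u)) ?S"
      unfolding excited_placements_eq[OF S] by blast
    have "A = B" unfolding B(3) by (rule fst[OF B(1)])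
    also have "B = T" by (rule placement_image_inj[OF S(1) B(1) T B(2)])
    finally show "A = T" .
  qed
qed

lemma OOE_eq:
  assumes S: "young (diagram mu)" "\<forall>u\<in>diagram mu. fst u \<le> length la"
  shows "OOE la mu = (\<lambda>T. placement (diagram mu) T ` diagram mu) ` OOT la mu"
proof -
  let ?S = "diagram mu" and ?d = "length la"
  have sub: "OOT la mu \<subseteq> ssyt ?S ?d" by (auto simp: OOT_def SSYT_def ssyt_def)
  have "excited_diagrams ?d mu = (\<lambda>T. placement ?S T ` ?S) ` ssyt ?S ?d"
    unfolding excited_diagrams_eq_placements[OF S] excited_placements_eq[OF S] by (rule image_image)
  then show ?thesis
    unfolding OOE_def using sub phi_placement[OF S] by auto
qed

text \<open>
  Reindexing by tableaux gives the sum over \<^term>\<open>OOT la mu\<close>; every other semistandard tableau has a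
  vanishing factor by \<open>factors_positive\<close>.
\<close>

lemma sum_OOE:
  assumes la: "antimono_on {..<length la} (\<lambda>i. part la (Suc i))"
    and S: "young (diagram mu)" "\<forall>u\<in>diagram mu. fst u \<le> length la"
  shows "(\<Sum>D\<in>OOE la mu. \<Prod>(i, j)\<in>D. real (part la (length la + 1 - i)) + real i - real j) =
    shifted_schur (length la) (\<lambda>i. real (part la (Suc i))) (diagram mu)"
proof -
  let ?S = "diagram mu" and ?d = "length la" and ?la = "\<lambda>i. part la (Suc i)"
  let ?x = "\<lambda>i. real (?la i)"
  have fin: "finite ?S" using S(1) by (simp add: young_def)
  have OOT: "OOT la mu = {T \<in> ssyt ?S ?d. \<forall>u\<in>?S. content u < int (part la (?d + 1 - T u))}"
    by (simp add: OOT_def SSYT_def ssyt_def)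
  have le: "T u \<le> ?d" if "T \<in> ssyt ?S ?d" "u \<in> ?S" for T u
    using that by (auto simp: ssyt_def dest: PiE_mem)
  have idx: "part la (?d + 1 - T u) = ?la (?d - T u)" if "T \<in> ssyt ?S ?d" "u \<in> ?S" for T u
    using le[OF that] by (simp add: Suc_diff_le)
  have weight: "(\<Prod>(i, j)\<in>placement ?S T ` ?S. real (part la (?d + 1 - i)) + real i - real j) = weight ?d ?x ?S T"
    if T: "T \<in> ssyt ?S ?d" for T
  proof -
    have "(\<Prod>(i, j)\<in>placement ?S T ` ?S. real (part la (?d + 1 - i)) + real i - real j) =
      (\<Prod>u\<in>?S. real (part la (?d + 1 - T u)) + real (T u) - real (T u + snd u - fst u))"
      by (subst prod.reindex[OF inj_on_placement[OF S(1) T]])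
        (auto simp: placement_def intro!: prod.cong)
    also have "\<dots> = weight ?d ?x ?S T"
      unfolding weight_def
    proof (rule prod.cong[OF refl])
      fix u assume u: "u \<in> ?S"
      have "fst u \<le> T u" by (rule ssyt_ge_fst[OF S(1) T u])
      then show "real (part la (?d + 1 - T u)) + real (T u) - real (T u + snd u - fst u) =
          ?x (?d - T u) - of_int (content u)"
        unfolding idx[OF T u] by (simp add: content_def of_nat_diff)
    qed
    finally show ?thesis .
  qed
  have inj: "inj_on (\<lambda>T. placement ?S T ` ?S) (OOT la mu)"
    unfolding OOT using placement_image_inj[OF S(1)] by (auto intro!: inj_onI)
  have "(\<Sum>D\<in>OOE la mu. \<Prod>(i, j)\<in>D. real (part la (?d + 1 - i)) + real i - real j) =
    (\<Sum>T\<in>OOT la mu. weight ?d ?x ?S T)"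
    unfolding OOE_eq[OF S] sum.reindex[OF inj] o_def
    by (rule sum.cong[OF refl], rule weight) (simp add: OOT)
  also have "\<dots> = (\<Sum>T\<in>ssyt ?S ?d. weight ?d ?x ?S T)"
  proof (rule sum.mono_neutral_left)
    show "finite (ssyt ?S ?d)" by (rule finite_ssyt[OF fin])
    show "OOT la mu \<subseteq> ssyt ?S ?d" unfolding OOT by blast
    show "\<forall>T\<in>ssyt ?S ?d - OOT la mu. weight ?d ?x ?S T = 0"
    proof
      fix T assume T: "T \<in> ssyt ?S ?d - OOT la mu"
      then obtain u where u: "u \<in> ?S" "\<not> content u < int (?la (?d - T u))"
        unfolding OOT using idx by auto
      have "\<exists>v\<in>?S. int (?la (?d - T v)) = content v"
      proof (rule ccontr)
        assume "\<not> ?thesis"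
        then have "content (fst u, snd u) < int (?la (?d - T (fst u, snd u)))"
          using T u(1) by (intro factors_positive[OF S(1) _ la]) auto
        with u(2) show False by simp
      qed
      then obtain v where v: "v \<in> ?S" "content v = int (?la (?d - T v))" by metis
      then have "?x (?d - T v) - of_int (content v) = 0" by simp
      with v(1) show "weight ?d ?x ?S T = 0" unfolding weight_def using fin by (intro prod_zero) auto
    qed
  qed
  finally show ?thesis by (simp add: shifted_schur_def)
qed

section \<open>The formula for partitions\<close>

lemma part_antimono:
  assumes "is_partition la"
  shows "antimono_on {..<d} (\<lambda>i. part la (Suc i))"
proof (rule monotone_onI)
  fix i j :: nat assume "i \<in> {..<d}" "j \<in> {..<d}" "i \<le> j"
  moreover have "sorted_wrt (\<ge>) la" using assms by (simp add: is_partition_def)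
  ultimately show "part la (Suc j) \<le> part la (Suc i)"
    by (cases "i = j") (auto simp: part_def sorted_wrt_iff_nth_less)
qed

lemma diagram_eq_row_shape:
  assumes "length la \<le> d"
  shows "diagram la = row_shape d (\<lambda>i. part la (Suc i))"
  using assms by (auto simp: diagram_def row_shape_def part_def split: if_splits)

text \<open>
  The hook splits into the arm with its corner and the leg without it, so the corner is counted once.
\<close>

lemma hook_length_eq:
  assumes la: "is_partition la" and ij: "i < length la" "j < part la (Suc i)"
  shows "hook_length la (Suc i, Suc j) = hook_size (length la) (\<lambda>i. part la (Suc i)) i j"
proof -
  let ?arm = "{Suc i} \<times> {Suc j..part la (Suc i)}"
  let ?leg = "(\<lambda>k. (Suc k, Suc j)) ` {k \<in> {Suc i..<length la}. j < part la (Suc k)}"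
  have "hook la (Suc i, Suc j) = ?arm \<union> ?leg"
  proof -
    have "(p, q) \<in> hook la (Suc i, Suc j) \<longleftrightarrow> (p, q) \<in> ?arm \<union> ?leg" for p q
      using ij by (cases p) (auto simp: hook_def diagram_def image_iff)
    then show ?thesis by auto
  qed
  moreover have "?arm \<inter> ?leg = {}" by auto
  moreover have "card ?leg = card {k \<in> {Suc i..<length la}. j < part la (Suc k)}"
    by (rule card_image) (auto simp: inj_on_def)
  ultimately show ?thesis
    unfolding hook_length_def hook_size_def by (simp add: card_Un_disjoint card_cartesian_product)
qed

theorem corollary5p4:
  fixes la mu :: "nat list" and d :: nat
  assumes "is_partition la" and "is_partition mu"
    and "d = length la"
    and "diagram mu \<subseteq> diagram la"
  shows "real (num_skew_SYT la mu) =
    fact (card (skew_diagram la mu)) / (\<Prod>u\<in>diagram la. real (hook_length la u)) *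
    (\<Sum>D\<in>OOE la mu. \<Prod>(i, j)\<in>D. real (part la (d + 1 - i)) + real i - real j)"
proof -
  let ?la = "\<lambda>i. part la (Suc i)" and ?mu = "\<lambda>i. part mu (Suc i)"
  have cell: "(Suc i, part mu (Suc i)) \<in> diagram la" if "0 < part mu (Suc i)" for i
  proof -
    have "(Suc i, part mu (Suc i)) \<in> diagram mu"
      using that by (auto simp: diagram_def part_def split: if_splits)
    with assms(4) show ?thesis by blast
  qed
  have "part mu (Suc (length mu - 1)) \<noteq> 0" if "mu \<noteq> []"
    using assms(2) that by (auto simp: is_partition_def part_def Suc_le_eq)
  then have len: "length mu \<le> d"
    using cell[of "length mu - 1"] assms(3) by (cases "mu = []") (auto simp: diagram_def)
  \<comment> \<open>Containment of diagrams becomes an inequality of parts; it is read off from the last cell of each row.\<close>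
  have le: "?mu i \<le> ?la i" for i
    using cell[of i] by (cases "?mu i = 0") (auto simp: diagram_def)
  have diag_la: "diagram la = row_shape d ?la" using assms(3) by (intro diagram_eq_row_shape) simp
  have diag_mu: "diagram mu = row_shape d ?mu" using len by (rule diagram_eq_row_shape)
  note anti_la = part_antimono[OF assms(1), of d] and anti_mu = part_antimono[OF assms(2), of d]
  have young: "young (diagram mu)" unfolding diag_mu by (rule young_row_shape[OF anti_mu])
  have rows: "\<forall>u\<in>diagram mu. fst u \<le> d" unfolding diag_mu by (auto simp: row_shape_def)
  let ?H = "real (\<Prod>i<d. \<Prod>j<?la i. hook_size d ?la i j)"
  have "(\<Prod>u\<in>diagram la. real (hook_length la u)) = (\<Prod>i<d. \<Prod>j<?la i. real (hook_length la (Suc i, Suc j)))"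
    unfolding diag_la by (rule prod_row_shape)
  also have "\<dots> = ?H"
    unfolding of_nat_prod using hook_length_eq[OF assms(1)] assms(3) by (intro prod.cong refl) simp
  finally have hooks: "(\<Prod>u\<in>diagram la. real (hook_length la u)) = ?H" .
  have H: "?H \<noteq> 0" by (simp add: hook_size_def)
  have "skew_SYT la mu = syt (skew_diagram la mu)"
    unfolding skew_SYT_def syt_def ..
  then have num: "num_skew_SYT la mu = card (syt (row_shape d ?la - row_shape d ?mu))"
    by (simp add: num_skew_SYT_def skew_diagram_def diag_la diag_mu)
  have skew: "skew_diagram la mu = row_shape d ?la - row_shape d ?mu"
    by (simp add: skew_diagram_def diag_la diag_mu)
  have sum: "(\<Sum>D\<in>OOE la mu. \<Prod>(i, j)\<in>D. real (part la (d + 1 - i)) + real i - real j) =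
     shifted_schur d (\<lambda>i. real (?la i)) (row_shape d ?mu)"
    using sum_OOE[of la mu] anti_la young rows unfolding assms(3)[symmetric] diag_mu by blast
  have "real (num_skew_SYT la mu) * ?H =
      fact (card (skew_diagram la mu)) * shifted_schur d (\<lambda>i. real (?la i)) (row_shape d ?mu)"
    unfolding num skew by (rule okounkov_olshanski[OF anti_la anti_mu le])
  then show ?thesis unfolding hooks sum times_divide_eq_left nonzero_eq_divide_eq[OF H] .
qed

end
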